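(* Let $(G_t)_{t\in[0,T]}$ be a centred Gaussian process with $G_0=0$ that is of type (A) or of type (B) (as defined in the context), with corresponding parameter $H$. Then, with probability $1$, $$\lim_{n\to\infty}\left(\frac{2^n}{T}\right)^{2H-1}\sum_{k=1}^{2^n}\left[G\left(\frac{kT}{2^n}\right)-G\left(\frac{(k-1)T}{2^n}\right)\right]^2=T .$$
   Context: $T>0$, $G(t)=G_t$, $R(s,t)=\mathbb{E}[G_tG_s]$, and $R^B(s,t)=\frac12\big(s^{2H}+t^{2H}-|t-s|^{2H}\big)$ is the covariance function of fractional Brownian motion with Hurst parameter $H$. Type (A): $H\in(0,1)$ and: for each fixed $s\in[0,T]$, $t\mapsto R(s,t)$ is absolutely continuous on $[0,T]$; for each fixed $t\in[0,T]$, $s\mapsto \frac{\partial R(s,t)}{\partial t}-\frac{\partial R^B(s,t)}{\partial t}$ is absolutely continuous on $[0,T]$; and there is a positive constant $C$ independent of $T$ such that $\Big|\frac{\partial}{\partial s}\Big(\frac{\partial R(s,t)}{\partial t}-\frac{\partial R^{B}(s,t)}{\partial t}\Big)\Big|\le C(ts)^{H-1}$ for almost every $(s,t)$. Type (B): $H\in(0,\frac12)$ and $R(s,t)=\frac12\big[(\max(s,t))^{2H}-|t-s|^{2H}\big]$. *)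

theory Defs
  imports "HOL-Probability.Probability"
begin

text \<open>Absolute continuity on \<open>{a..b}\<close>. A finite family of nonoverlapping compact
  subintervals is given by the set of its pairs of endpoints.\<close>

definition abs_continuous_on_interval :: "real \<Rightarrow> real \<Rightarrow> (real \<Rightarrow> real) \<Rightarrow> bool" where
  "abs_continuous_on_interval a b f \<longleftrightarrow>
     (\<forall>\<epsilon>>0. \<exists>\<delta>>0. \<forall>I :: (real \<times> real) set.
        finite I \<longrightarrow>
        (\<forall>(u, v)\<in>I. a \<le> u \<and> u < v \<and> v \<le> b) \<longrightarrow>
        pairwise (\<lambda>p q. {fst p<..<snd p} \<inter> {fst q<..<snd q} = {}) I \<longrightarrow>
        (\<Sum>(u, v)\<in>I. v - u) < \<delta> \<longrightarrow>
        (\<Sum>(u, v)\<in>I. \<bar>f v - f u\<bar>) < \<epsilon>)"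

text \<open>Constants count as (degenerate) Gaussian random variables.\<close>

definition gaussian_rv :: "'a measure \<Rightarrow> ('a \<Rightarrow> real) \<Rightarrow> bool" where
  "gaussian_rv M X \<longleftrightarrow>
     X \<in> borel_measurable M \<and>
     ((\<exists>\<mu> \<sigma>. \<sigma> > 0 \<and> distributed M lborel X (normal_density \<mu> \<sigma>)) \<or>
      (\<exists>\<mu>. AE \<omega> in M. X \<omega> = \<mu>))"

definition centred_gaussian_process ::
    "'a measure \<Rightarrow> real set \<Rightarrow> (real \<Rightarrow> 'a \<Rightarrow> real) \<Rightarrow> bool" where
  "centred_gaussian_process M S G \<longleftrightarrow>
     prob_space M \<and>
     (\<forall>J c. finite J \<and> J \<subseteq> S \<longrightarrow> gaussian_rv M (\<lambda>\<omega>. \<Sum>t\<in>J. c t * G t \<omega>)) \<and>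
     (\<forall>t\<in>S. prob_space.expectation M (G t) = 0)"

definition cov_fun :: "'a measure \<Rightarrow> (real \<Rightarrow> 'a \<Rightarrow> real) \<Rightarrow> real \<Rightarrow> real \<Rightarrow> real" where
  "cov_fun M G s t = prob_space.expectation M (\<lambda>\<omega>. G t \<omega> * G s \<omega>)"

definition fbm_cov :: "real \<Rightarrow> real \<Rightarrow> real \<Rightarrow> real" where
  "fbm_cov H s t =
     (s powr (2 * H) + t powr (2 * H) - \<bar>t - s\<bar> powr (2 * H)) / 2"

text \<open>\<open>D s t\<close> stands for \<open>\<partial>R(s,t)/\<partial>t - \<partial>R\<^sup>B(s,t)/\<partial>t\<close>. Both functions are
  absolutely continuous in \<open>t\<close>, so these derivatives exist only for almost every \<open>t\<close>
  (for \<open>H \<le> 1/2\<close> the derivative of \<open>R\<^sup>B\<close> does not exist at \<open>t = s \<in> {0<..<T}\<close>, and for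
  \<open>H < 1/2\<close> not at \<open>t = 0\<close> when \<open>s > 0\<close>). The difference is therefore a function that
  agrees with the classical one for each \<open>s\<close> and almost every \<open>t\<close>, for instance its
  continuous extension across \<open>s = t\<close>.

  The horizon \<open>T\<close> is fixed, so a constant \<open>C\<close> that does not depend on \<open>T\<close> is a
  special case of the \<open>C\<close> below.\<close>

definition type_A :: "real \<Rightarrow> real \<Rightarrow> (real \<Rightarrow> real \<Rightarrow> real) \<Rightarrow> bool" where
  "type_A T H R \<longleftrightarrow>
     0 < H \<and> H < 1 \<and>
     (\<forall>s\<in>{0..T}. abs_continuous_on_interval 0 T (\<lambda>t. R s t)) \<and>
     (\<exists>D :: real \<Rightarrow> real \<Rightarrow> real.
        (\<forall>s\<in>{0..T}. AE t in lborel. t \<in> {0..T} \<longrightarrow>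
           (\<exists>r b. ((\<lambda>t. R s t) has_real_derivative r) (at t within {0..T}) \<and>
                  ((\<lambda>t. fbm_cov H s t) has_real_derivative b) (at t within {0..T}) \<and>
                  D s t = r - b)) \<and>
        (\<forall>t\<in>{0..T}. abs_continuous_on_interval 0 T (\<lambda>s. D s t)) \<and>
        (\<exists>C>0. AE (s, t) in lborel \<Otimes>\<^sub>M lborel. s \<in> {0..T} \<longrightarrow> t \<in> {0..T} \<longrightarrow>
           (\<exists>d. ((\<lambda>s. D s t) has_real_derivative d) (at s within {0..T}) \<and>
                \<bar>d\<bar> \<le> C * (t * s) powr (H - 1))))"

definition type_B :: "real \<Rightarrow> real \<Rightarrow> (real \<Rightarrow> real \<Rightarrow> real) \<Rightarrow> bool" where
  "type_B T H R \<longleftrightarrow>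
     0 < H \<and> H < 1 / 2 \<and>
     (\<forall>s\<in>{0..T}. \<forall>t\<in>{0..T}.
        R s t = (max s t powr (2 * H) - \<bar>t - s\<bar> powr (2 * H)) / 2)"

end

theory Submission
  imports Defs
begin

text \<open>Let \<open>h = T / 2\<^sup>n\<close>. On the dyadic grid the covariance of the increments numbered \<open>j\<close> and \<open>k\<close>
  is \<open>h\<^sup>2\<^sup>H (\<rho>(j - k) + \<theta>(j, k))\<close>, where \<open>\<rho>\<close> is the covariance of fractional Gaussian noise and
  \<open>\<theta>\<close> is a small perturbation: for type (A) it is bounded by a multiple of \<open>a j * a k\<close> with
  \<open>a k = k\<^sup>H - (k - 1)\<^sup>H\<close>, by integrating the bound on the mixed derivative over a grid cell, and for type
  (B) it is diagonal. Hence the scaled sum of squares has mean tending to \<open>T\<close>. Its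
  variance is, by Isserlis' theorem, twice the sum of the squared covariances, which
  decays geometrically in \<open>n\<close>; so the squared deviations from the mean are almost surely
  summable.\<close>

section \<open>Moments of Gaussian random variables\<close>

text \<open>The scaling factor is h^(1-2H), so against a covariance of order h^(2H) a single h = T/N
  with N = 2^n remains. The mean then needs only a diagonal sum of \<open>\<theta>\<close> of order
  N^beta with beta < 1. The variance carries h^2, of order N^(-2), against double sums of squares of
  order at most N^(1 + max 0 (2H-1)) for \<open>\<rho>\<close> and N^(2 beta) for
  \<open>\<theta>\<close>. Both exponents are below 2 for every H < 1, and as N is itself geometric
  in n, any negative power of N is summable; hence no threshold such as H = 3/4 appears. Here beta
  is H for type (A), since the a k telescope to N^H, and 2H for type (B), where H < 1/2 keeps it
  below 1. The obstacle in type (A) is that derivatives exist only almost everywhere and their bound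
  blows up at 0. The mixed derivative itself is not integrated: a comparison theorem bounds the
  increments of an absolutely continuous function by those of a monotone function whose derivative
  dominates almost everywhere. It is applied once in each variable, with x^H / H as primitive of
  x^(H-1).\<close>

lemma (in prob_space) integrable_gaussian_rv_power:
  assumes "gaussian_rv M X"
  shows "integrable M (\<lambda>\<omega>. X \<omega> ^ k)"
proof -
  have m[measurable]: "X \<in> borel_measurable M"
    using assms by (simp add: gaussian_rv_def)
  consider \<mu> \<sigma> where "\<sigma> > 0" "distributed M lborel X (normal_density \<mu> \<sigma>)"
    | \<mu> where "AE \<omega> in M. X \<omega> = \<mu>"
    using assms unfolding gaussian_rv_def by blast
  then show ?thesis
  proof cases
    case 1
    note D = 1(2)
    have "integrable lborel (\<lambda>x. normal_density \<mu> \<sigma> x * (x - \<mu>) ^ j)" for j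
      using 1(1) by (rule integrable_normal_moment)
    then have c: "integrable M (\<lambda>\<omega>. (X \<omega> - \<mu>) ^ j)" for j
      using distributed_integrable[OF D, of "\<lambda>x. (x - \<mu>) ^ j"] by simp
    \<comment> \<open>Integrability is available for moments about the mean; the binomial theorem
      transfers it to plain powers.\<close>
    have eq: "X \<omega> ^ k = (\<Sum>j\<le>k. of_nat (k choose j) * (X \<omega> - \<mu>) ^ j * \<mu> ^ (k - j))" for \<omega>
      using binomial_ring[of "X \<omega> - \<mu>" \<mu> k] by simp
    show ?thesis
      unfolding eq by (intro Bochner_Integration.integrable_sum integrable_mult_left integrable_mult_right c)
  next
    case 2
    then have "AE \<omega> in M. \<mu> ^ k = X \<omega> ^ k" by eventually_elim simp
    moreover have "integrable M (\<lambda>\<omega>. \<mu> ^ k)" by simp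
    ultimately show ?thesis
      by (subst integrable_cong_AE[of _ M "\<lambda>\<omega>. \<mu> ^ k"]) (auto elim: eventually_mono)
  qed
qed

lemma (in prob_space) gaussian_rv_fourth_moment:
  assumes "gaussian_rv M X" and "expectation X = 0"
  shows "expectation (\<lambda>\<omega>. X \<omega> ^ 4) = 3 * (expectation (\<lambda>\<omega>. (X \<omega>)\<^sup>2))\<^sup>2"
proof -
  have m[measurable]: "X \<in> borel_measurable M"
    using assms by (simp add: gaussian_rv_def)
  consider \<mu> \<sigma> where "\<sigma> > 0" "distributed M lborel X (normal_density \<mu> \<sigma>)"
    | \<mu> where "AE \<omega> in M. X \<omega> = \<mu>"
    using assms unfolding gaussian_rv_def by blast
  then show ?thesis
  proof cases
    case 1
    note D = 1(2)
    have "\<mu> = 0"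
      using normal_distributed_expectation[OF 1] assms(2) by simp
    then have e: "expectation (\<lambda>\<omega>. X \<omega> ^ (2 * j)) = fact (2 * j) / ((2 / \<sigma>\<^sup>2)^j * fact j)" for j
      using distributed_integral[OF D, of "\<lambda>x. x ^ (2 * j)"] integral_normal_moment_even[OF 1(1), of \<mu> j]
      by simp
    show ?thesis
      \<comment> \<open>The values at j = 1 and j = 2 are sigma^2 and 3 sigma^4.\<close>
      using e[of 1] e[of 2] 1(1) by (simp add: fact_numeral field_simps power2_eq_square)
  next
    case 2
    have "expectation X = expectation (\<lambda>_. \<mu>)"
      by (intro integral_cong_AE) (use 2 in auto)
    then have "\<mu> = 0" using assms(2) by (simp add: prob_space)
    with 2 have "AE \<omega> in M. X \<omega> ^ 4 = 0" "AE \<omega> in M. (X \<omega>)\<^sup>2 = 0"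
      by (auto elim: eventually_mono)
    then have "expectation (\<lambda>\<omega>. X \<omega> ^ 4) = 0" "expectation (\<lambda>\<omega>. (X \<omega>)\<^sup>2) = 0"
      by (auto intro: integral_eq_zero_AE)
    then show ?thesis by simp
  qed
qed

text \<open>The case of Isserlis' theorem needed here, obtained by polarising the fourth moments of
  \<open>X + Y\<close> and \<open>X - Y\<close>.\<close>

lemma (in prob_space) gaussian_rv_isserlis:
  assumes X: "gaussian_rv M X" "expectation X = 0"
    and Y: "gaussian_rv M Y" "expectation Y = 0"
    and P: "gaussian_rv M (\<lambda>\<omega>. X \<omega> + Y \<omega>)"
    and N: "gaussian_rv M (\<lambda>\<omega>. X \<omega> - Y \<omega>)"
  shows "integrable M (\<lambda>\<omega>. X \<omega> * Y \<omega>)"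
    and "integrable M (\<lambda>\<omega>. (X \<omega>)\<^sup>2 * (Y \<omega>)\<^sup>2)"
    and "expectation (\<lambda>\<omega>. (X \<omega>)\<^sup>2 * (Y \<omega>)\<^sup>2) =
      expectation (\<lambda>\<omega>. (X \<omega>)\<^sup>2) * expectation (\<lambda>\<omega>. (Y \<omega>)\<^sup>2) + 2 * (expectation (\<lambda>\<omega>. X \<omega> * Y \<omega>))\<^sup>2"
proof -
  note iX = integrable_gaussian_rv_power[OF X(1)] and iY = integrable_gaussian_rv_power[OF Y(1)]
    and iP = integrable_gaussian_rv_power[OF P] and iN = integrable_gaussian_rv_power[OF N]
  have i1: "integrable M X" "integrable M Y"
    using iX[of 1] iY[of 1] by simp_all
  have "(\<lambda>\<omega>. X \<omega> * Y \<omega>) = (\<lambda>\<omega>. ((X \<omega> + Y \<omega>)\<^sup>2 - (X \<omega> - Y \<omega>)\<^sup>2) / 4)"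
    by (simp add: fun_eq_iff power2_eq_square algebra_simps)
  then show ic: "integrable M (\<lambda>\<omega>. X \<omega> * Y \<omega>)"
    using iP[of 2] iN[of 2] by simp
  \<comment> \<open>In (X + Y)^4 + (X - Y)^4 the odd mixed terms cancel, leaving 2 X^4 + 12 X^2 Y^2
    + 2 Y^4.\<close>
  have eq: "(\<lambda>\<omega>. (X \<omega>)\<^sup>2 * (Y \<omega>)\<^sup>2) =
    (\<lambda>\<omega>. ((X \<omega> + Y \<omega>) ^ 4 + (X \<omega> - Y \<omega>) ^ 4 - 2 * X \<omega> ^ 4 - 2 * Y \<omega> ^ 4) / 12)"
    by (simp add: fun_eq_iff power2_eq_square power4_eq_xxxx algebra_simps)
  show "integrable M (\<lambda>\<omega>. (X \<omega>)\<^sup>2 * (Y \<omega>)\<^sup>2)"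
    unfolding eq using iP[of 4] iN[of 4] iX[of 4] iY[of 4] by simp
  define a b c where "a = expectation (\<lambda>\<omega>. (X \<omega>)\<^sup>2)" "b = expectation (\<lambda>\<omega>. (Y \<omega>)\<^sup>2)"
    "c = expectation (\<lambda>\<omega>. X \<omega> * Y \<omega>)"
  have "(\<lambda>\<omega>. (X \<omega> + Y \<omega>)\<^sup>2) = (\<lambda>\<omega>. (X \<omega>)\<^sup>2 + 2 * (X \<omega> * Y \<omega>) + (Y \<omega>)\<^sup>2)"
    by (simp add: fun_eq_iff power2_sum algebra_simps)
  then have sP: "expectation (\<lambda>\<omega>. (X \<omega> + Y \<omega>)\<^sup>2) = a + 2 * c + b"
    using iX[of 2] iY[of 2] ic by (simp add: a_b_c_def)
  have "(\<lambda>\<omega>. (X \<omega> - Y \<omega>)\<^sup>2) = (\<lambda>\<omega>. (X \<omega>)\<^sup>2 - 2 * (X \<omega> * Y \<omega>) + (Y \<omega>)\<^sup>2)"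
    by (simp add: fun_eq_iff power2_diff algebra_simps)
  then have sN: "expectation (\<lambda>\<omega>. (X \<omega> - Y \<omega>)\<^sup>2) = a - 2 * c + b"
    using iX[of 2] iY[of 2] ic by (simp add: a_b_c_def)
  have "expectation (\<lambda>\<omega>. X \<omega> + Y \<omega>) = 0" "expectation (\<lambda>\<omega>. X \<omega> - Y \<omega>) = 0"
    using X Y i1 by simp_all
  note f = gaussian_rv_fourth_moment[OF P this(1)] gaussian_rv_fourth_moment[OF N this(2)]
    gaussian_rv_fourth_moment[OF X] gaussian_rv_fourth_moment[OF Y]
  have "expectation (\<lambda>\<omega>. (X \<omega>)\<^sup>2 * (Y \<omega>)\<^sup>2) =
      (3 * (a + 2 * c + b)\<^sup>2 + 3 * (a - 2 * c + b)\<^sup>2 - 2 * (3 * a\<^sup>2) - 2 * (3 * b\<^sup>2)) / 12"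
    unfolding eq using iP[of 4] iN[of 4] iX[of 4] iY[of 4] by (simp add: f sP sN flip: a_b_c_def)
  also have "\<dots> = a * b + 2 * c\<^sup>2"
    by (simp add: power2_eq_square field_simps)
  finally show "expectation (\<lambda>\<omega>. (X \<omega>)\<^sup>2 * (Y \<omega>)\<^sup>2) =
    expectation (\<lambda>\<omega>. (X \<omega>)\<^sup>2) * expectation (\<lambda>\<omega>. (Y \<omega>)\<^sup>2) + 2 * (expectation (\<lambda>\<omega>. X \<omega> * Y \<omega>))\<^sup>2"
    by (simp add: a_b_c_def)
qed

section \<open>Increments of a centred Gaussian process\<close>

text \<open>Linear combinations are indexed by a set of times, and the endpoints may coincide, as
  they do for equal or adjacent grid cells. The coefficient of a time is therefore a sum of
  indicators, which adds up correctly under any coincidence.\<close>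

lemma centred_gaussian_process_gaussian_rv_increments:
  assumes "centred_gaussian_process M S G" and "{u, v, u', v'} \<subseteq> S"
  shows "gaussian_rv M (\<lambda>\<omega>. a * (G v \<omega> - G u \<omega>) + b * (G v' \<omega> - G u' \<omega>))"
proof -
  let ?J = "{u, v, u', v'}"
  let ?c = "\<lambda>t. a * (of_bool (t = v) - of_bool (t = u)) + b * (of_bool (t = v') - of_bool (t = u')) :: real"
  have "(\<Sum>t\<in>?J. ?c t * G t \<omega>) = a * (G v \<omega> - G u \<omega>) + b * (G v' \<omega> - G u' \<omega>)" for \<omega>
  proof -
    have d: "(\<Sum>t\<in>?J. of_bool (t = w) * G t \<omega>) = G w \<omega>" if "w \<in> ?J" for w
      using that by (subst sum.mono_neutral_right[of ?J "{w}"]) auto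
    have "(\<Sum>t\<in>?J. ?c t * G t \<omega>) =
      a * (\<Sum>t\<in>?J. of_bool (t = v) * G t \<omega>) - a * (\<Sum>t\<in>?J. of_bool (t = u) * G t \<omega>) +
      b * (\<Sum>t\<in>?J. of_bool (t = v') * G t \<omega>) - b * (\<Sum>t\<in>?J. of_bool (t = u') * G t \<omega>)"
      unfolding sum_distrib_left sum_subtractf[symmetric] sum.distrib[symmetric]
      by (intro sum.cong refl) (simp add: algebra_simps)
    also have "\<dots> = a * (G v \<omega> - G u \<omega>) + b * (G v' \<omega> - G u' \<omega>)"
      by (subst (1 2 3 4) d) (simp_all add: algebra_simps)
    finally show ?thesis .
  qed
  moreover have "gaussian_rv M (\<lambda>\<omega>. \<Sum>t\<in>?J. ?c t * G t \<omega>)"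
    using assms unfolding centred_gaussian_process_def
    by (elim conjE allE[of _ ?J] allE[of _ ?c]) simp
  ultimately show ?thesis by (simp only:)
qed

lemma centred_gaussian_process_gaussian_rv:
  assumes "centred_gaussian_process M S G" and "t \<in> S"
  shows "gaussian_rv M (G t)"
proof -
  have "gaussian_rv M (\<lambda>\<omega>. \<Sum>t\<in>{t}. 1 * G t \<omega>)"
    using assms unfolding centred_gaussian_process_def
    by (elim conjE allE[of _ "{t}"] allE[of _ "\<lambda>_. 1"]) simp
  then show ?thesis by simp
qed

lemma centred_gaussian_process_increments:
  assumes G: "centred_gaussian_process M S G" and S: "{u, v, u', v'} \<subseteq> S"
  shows "integrable M (\<lambda>\<omega>. (G v \<omega> - G u \<omega>)\<^sup>2)"
    and "integrable M (\<lambda>\<omega>. (G v \<omega> - G u \<omega>)\<^sup>2 * (G v' \<omega> - G u' \<omega>)\<^sup>2)"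
    and "prob_space.expectation M (\<lambda>\<omega>. (G v \<omega> - G u \<omega>)\<^sup>2 * (G v' \<omega> - G u' \<omega>)\<^sup>2) =
      prob_space.expectation M (\<lambda>\<omega>. (G v \<omega> - G u \<omega>)\<^sup>2) * prob_space.expectation M (\<lambda>\<omega>. (G v' \<omega> - G u' \<omega>)\<^sup>2)
      + 2 * (prob_space.expectation M (\<lambda>\<omega>. (G v \<omega> - G u \<omega>) * (G v' \<omega> - G u' \<omega>)))\<^sup>2"
    and "prob_space.expectation M (\<lambda>\<omega>. (G v \<omega> - G u \<omega>) * (G v' \<omega> - G u' \<omega>)) =
      cov_fun M G v v' - cov_fun M G v u' - cov_fun M G u v' + cov_fun M G u u'"
proof -
  interpret prob_space M
    using G by (simp add: centred_gaussian_process_def)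
  let ?X = "\<lambda>\<omega>. G v \<omega> - G u \<omega>" and ?Y = "\<lambda>\<omega>. G v' \<omega> - G u' \<omega>"
  note inc = centred_gaussian_process_gaussian_rv_increments[OF G S]
  \<comment> \<open>The coefficient pairs (1,0), (0,1), (1,1), (1,-1) give the four variables that
    Isserlis' theorem asks for.\<close>
  have g: "gaussian_rv M ?X" "gaussian_rv M ?Y" "gaussian_rv M (\<lambda>\<omega>. ?X \<omega> + ?Y \<omega>)" "gaussian_rv M (\<lambda>\<omega>. ?X \<omega> - ?Y \<omega>)"
    using inc[of 1 0] inc[of 0 1] inc[of 1 1] inc[of 1 "-1"] by (simp_all add: algebra_simps)
  have i: "integrable M (G t)" if "t \<in> S" for t
    using integrable_gaussian_rv_power[OF centred_gaussian_process_gaussian_rv[OF G that], of 1] by simp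
  have z: "expectation (G t) = 0" if "t \<in> S" for t
    using G that by (simp add: centred_gaussian_process_def)
  have e: "expectation ?X = 0" "expectation ?Y = 0"
    using S by (simp_all add: i z)
  note r = gaussian_rv_isserlis[OF g(1) e(1) g(2) e(2) g(3,4)]
  show "integrable M (\<lambda>\<omega>. (?X \<omega>)\<^sup>2)"
    by (rule integrable_gaussian_rv_power[OF g(1)])
  show "integrable M (\<lambda>\<omega>. (?X \<omega>)\<^sup>2 * (?Y \<omega>)\<^sup>2)"
    "expectation (\<lambda>\<omega>. (?X \<omega>)\<^sup>2 * (?Y \<omega>)\<^sup>2) = expectation (\<lambda>\<omega>. (?X \<omega>)\<^sup>2) * expectation (\<lambda>\<omega>. (?Y \<omega>)\<^sup>2) + 2 * (expectation (\<lambda>\<omega>. ?X \<omega> * ?Y \<omega>))\<^sup>2"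
    by (fact r)+
  \<comment> \<open>Needed to expand the product of increments by linearity; the dominating function
    is the sum of the two squares.\<close>
  have p: "integrable M (\<lambda>\<omega>. G t \<omega> * G s \<omega>)" if "t \<in> S" "s \<in> S" for s t
  proof (rule Bochner_Integration.integrable_bound)
    show "integrable M (\<lambda>\<omega>. (G t \<omega>)\<^sup>2 + (G s \<omega>)\<^sup>2)"
      using integrable_gaussian_rv_power[OF centred_gaussian_process_gaussian_rv[OF G], of _ 2] that by simp
    show "(\<lambda>\<omega>. G t \<omega> * G s \<omega>) \<in> borel_measurable M"
      using i that by (auto dest: borel_measurable_integrable)
    show "AE \<omega> in M. norm (G t \<omega> * G s \<omega>) \<le> norm ((G t \<omega>)\<^sup>2 + (G s \<omega>)\<^sup>2)"
    proof (rule AE_I2)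
      fix \<omega>
      have "2 * \<bar>G t \<omega>\<bar> * \<bar>G s \<omega>\<bar> \<le> (G t \<omega>)\<^sup>2 + (G s \<omega>)\<^sup>2"
        using sum_squares_bound[of "\<bar>G t \<omega>\<bar>" "\<bar>G s \<omega>\<bar>"] by simp
      moreover have "0 \<le> \<bar>G t \<omega>\<bar> * \<bar>G s \<omega>\<bar>" by simp
      ultimately have "\<bar>G t \<omega>\<bar> * \<bar>G s \<omega>\<bar> \<le> (G t \<omega>)\<^sup>2 + (G s \<omega>)\<^sup>2" by linarith
      then show "norm (G t \<omega> * G s \<omega>) \<le> norm ((G t \<omega>)\<^sup>2 + (G s \<omega>)\<^sup>2)"
        by (simp add: abs_mult)
    qed
  qed
  have "(\<lambda>\<omega>. ?X \<omega> * ?Y \<omega>) = (\<lambda>\<omega>. G v' \<omega> * G v \<omega> - G u' \<omega> * G v \<omega> - G v' \<omega> * G u \<omega> + G u' \<omega> * G u \<omega>)"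
    by (simp add: fun_eq_iff algebra_simps)
  then show "expectation (\<lambda>\<omega>. ?X \<omega> * ?Y \<omega>) =
      cov_fun M G v v' - cov_fun M G v u' - cov_fun M G u v' + cov_fun M G u u'"
    using S by (simp add: p cov_fun_def)
qed

section \<open>Absolutely continuous functions\<close>

lemma abs_continuous_on_interval_subset:
  assumes "abs_continuous_on_interval a b f" and "a \<le> a'" and "b' \<le> b"
  shows "abs_continuous_on_interval a' b' f"
  unfolding abs_continuous_on_interval_def
proof (intro allI impI)
  fix e :: real assume "e > 0"
  then obtain d where "d > 0" and d: "\<And>I :: (real \<times> real) set. finite I \<Longrightarrow>
        \<forall>(u, v)\<in>I. a \<le> u \<and> u < v \<and> v \<le> b \<Longrightarrow>
        pairwise (\<lambda>p q. {fst p<..<snd p} \<inter> {fst q<..<snd q} = {}) I \<Longrightarrow>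
        (\<Sum>(u, v)\<in>I. v - u) < d \<Longrightarrow> (\<Sum>(u, v)\<in>I. \<bar>f v - f u\<bar>) < e"
    using assms(1) unfolding abs_continuous_on_interval_def by blast
  show "\<exists>d>0. \<forall>I :: (real \<times> real) set. finite I \<longrightarrow>
        (\<forall>(u, v)\<in>I. a' \<le> u \<and> u < v \<and> v \<le> b') \<longrightarrow>
        pairwise (\<lambda>p q. {fst p<..<snd p} \<inter> {fst q<..<snd q} = {}) I \<longrightarrow>
        (\<Sum>(u, v)\<in>I. v - u) < d \<longrightarrow> (\<Sum>(u, v)\<in>I. \<bar>f v - f u\<bar>) < e"
    proof (intro exI[of _ d] conjI allI impI)
    fix I :: "(real \<times> real) set"
    assume I: "finite I" "\<forall>(u, v)\<in>I. a' \<le> u \<and> u < v \<and> v \<le> b'"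
      "pairwise (\<lambda>p q. {fst p<..<snd p} \<inter> {fst q<..<snd q} = {}) I"
      "(\<Sum>(u, v)\<in>I. v - u) < d"
    from I(2) have "\<forall>(u, v)\<in>I. a \<le> u \<and> u < v \<and> v \<le> b"
      using assms(2,3) by fastforce
    then show "(\<Sum>(u, v)\<in>I. \<bar>f v - f u\<bar>) < e"
      by (rule d[OF I(1) _ I(3,4)])
  qed (fact \<open>d > 0\<close>)
qed

text \<open>Two dominating functions suffice for closure under sums and differences, the only
  combinations that occur later.\<close>

lemma abs_continuous_on_interval_bound:
  assumes "abs_continuous_on_interval a b f" and "abs_continuous_on_interval a b g"
    and h: "\<And>u v. a \<le> u \<Longrightarrow> u < v \<Longrightarrow> v \<le> b \<Longrightarrow> \<bar>h v - h u\<bar> \<le> \<bar>f v - f u\<bar> + \<bar>g v - g u\<bar>"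
  shows "abs_continuous_on_interval a b h"
  unfolding abs_continuous_on_interval_def
proof (intro allI impI)
  fix e :: real assume "e > 0"
  then have "e / 2 > 0" by simp
  obtain d1 where "d1 > 0" and d1: "\<And>I :: (real \<times> real) set. finite I \<Longrightarrow>
        \<forall>(u, v)\<in>I. a \<le> u \<and> u < v \<and> v \<le> b \<Longrightarrow>
        pairwise (\<lambda>p q. {fst p<..<snd p} \<inter> {fst q<..<snd q} = {}) I \<Longrightarrow>
        (\<Sum>(u, v)\<in>I. v - u) < d1 \<Longrightarrow> (\<Sum>(u, v)\<in>I. \<bar>f v - f u\<bar>) < e / 2"
    using assms(1) \<open>e / 2 > 0\<close> unfolding abs_continuous_on_interval_def by blast
  obtain d2 where "d2 > 0" and d2: "\<And>I :: (real \<times> real) set. finite I \<Longrightarrow>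
        \<forall>(u, v)\<in>I. a \<le> u \<and> u < v \<and> v \<le> b \<Longrightarrow>
        pairwise (\<lambda>p q. {fst p<..<snd p} \<inter> {fst q<..<snd q} = {}) I \<Longrightarrow>
        (\<Sum>(u, v)\<in>I. v - u) < d2 \<Longrightarrow> (\<Sum>(u, v)\<in>I. \<bar>g v - g u\<bar>) < e / 2"
    using assms(2) \<open>e / 2 > 0\<close> unfolding abs_continuous_on_interval_def by blast
  show "\<exists>d>0. \<forall>I :: (real \<times> real) set. finite I \<longrightarrow>
        (\<forall>(u, v)\<in>I. a \<le> u \<and> u < v \<and> v \<le> b) \<longrightarrow>
        pairwise (\<lambda>p q. {fst p<..<snd p} \<inter> {fst q<..<snd q} = {}) I \<longrightarrow>
        (\<Sum>(u, v)\<in>I. v - u) < d \<longrightarrow> (\<Sum>(u, v)\<in>I. \<bar>h v - h u\<bar>) < e"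
  proof (intro exI[of _ "min d1 d2"] conjI allI impI)
    fix I :: "(real \<times> real) set"
    assume I: "finite I" "\<forall>(u, v)\<in>I. a \<le> u \<and> u < v \<and> v \<le> b"
      "pairwise (\<lambda>p q. {fst p<..<snd p} \<inter> {fst q<..<snd q} = {}) I"
      "(\<Sum>(u, v)\<in>I. v - u) < min d1 d2"
    have "(\<Sum>(u, v)\<in>I. \<bar>h v - h u\<bar>) \<le> (\<Sum>(u, v)\<in>I. \<bar>f v - f u\<bar> + \<bar>g v - g u\<bar>)"
      using I(2) h by (intro sum_mono) fastforce
    also have "\<dots> = (\<Sum>(u, v)\<in>I. \<bar>f v - f u\<bar>) + (\<Sum>(u, v)\<in>I. \<bar>g v - g u\<bar>)"
      by (simp add: sum.distrib split_def)
    also have "\<dots> < e / 2 + e / 2"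
      using I by (intro add_strict_mono d1 d2) auto
    finally show "(\<Sum>(u, v)\<in>I. \<bar>h v - h u\<bar>) < e" by simp
  qed (use \<open>d1 > 0\<close> \<open>d2 > 0\<close> in simp)
qed

text \<open>A monotone map sends nonoverlapping intervals to disjoint, possibly empty, open
  intervals between the images of the endpoints, so their lengths add up inside \<open>U\<close>. It
  serves once with \<open>q\<close> of small range and once with \<open>q\<close> the identity and
  \<open>U\<close> a small neighbourhood of a null set.\<close>

lemma sum_mono_increments_le_emeasure:
  fixes I :: "(real \<times> real) set" and q :: "real \<Rightarrow> real"
  assumes "finite I" and q: "mono q" and lt: "\<And>u v. (u, v) \<in> I \<Longrightarrow> u < v"
    and dis: "pairwise (\<lambda>p q. {fst p<..<snd p} \<inter> {fst q<..<snd q} = {}) I"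
    and U: "U \<in> sets borel" "\<And>u v. (u, v) \<in> I \<Longrightarrow> {q u<..<q v} \<subseteq> U"
  shows "ennreal (\<Sum>(u, v)\<in>I. q v - q u) \<le> emeasure lborel U"
proof -
  let ?F = "\<lambda>p. {q (fst p)<..<q (snd p)}"
  have "disjoint_family_on ?F I"
    unfolding disjoint_family_on_def
  proof (intro ballI impI)
    fix p p' assume p: "p \<in> I" "p' \<in> I" "p \<noteq> p'"
    then have "{fst p<..<snd p} \<inter> {fst p'<..<snd p'} = {}"
      using dis by (auto simp: pairwise_def)
    moreover have "fst p < snd p" "fst p' < snd p'"
      using p lt by (metis prod.collapse)+
    \<comment> \<open>If neither interval preceded the other, a point between the larger left end
      and the smaller right end would lie in both.\<close>
    ultimately have "snd p \<le> fst p' \<or> snd p' \<le> fst p"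
      using dense[of "max (fst p) (fst p')" "min (snd p) (snd p')"] by fastforce
    then have "q (snd p) \<le> q (fst p') \<or> q (snd p') \<le> q (fst p)"
      using q by (auto dest: monoD)
    then show "?F p \<inter> ?F p' = {}" by auto
  qed
  then have "(\<Sum>p\<in>I. emeasure lborel (?F p)) = emeasure lborel (\<Union>p\<in>I. ?F p)"
    using \<open>finite I\<close> by (intro sum_emeasure) auto
  also have "\<dots> \<le> emeasure lborel U"
  proof (rule emeasure_mono)
    show "(\<Union>p\<in>I. ?F p) \<subseteq> U"
      using U(2) by (intro UN_least) (metis prod.collapse)
  qed (use U(1) in simp)
  finally have "(\<Sum>p\<in>I. emeasure lborel (?F p)) \<le> emeasure lborel U" .
  moreover have le: "q (fst p) \<le> q (snd p)" if "p \<in> I" for p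
    using lt[of "fst p" "snd p"] that by (intro monoD[OF q] less_imp_le) simp
  then have "(\<Sum>p\<in>I. emeasure lborel (?F p)) = (\<Sum>p\<in>I. ennreal (q (snd p) - q (fst p)))"
    by (intro sum.cong refl emeasure_lborel_Ioo)
  moreover have "\<dots> = ennreal (\<Sum>p\<in>I. q (snd p) - q (fst p))"
    using le by (intro sum_ennreal) simp
  ultimately show ?thesis by (simp only: split_def)
qed

section \<open>Absolute continuity of the covariance of fractional Brownian motion\<close>

text \<open>For p < 1 the slope is infinite at s. The power is cut at distance eta: |x|^p = min(|x|,
  eta)^p + max(|x|, eta)^p - eta^p. The first part has small total variation whatever the intervals,
  the second is Lipschitz.\<close>

lemma abs_continuous_on_interval_abs_powr:
  fixes a b s p :: real
  assumes "p > 0"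
  shows "abs_continuous_on_interval a b (\<lambda>t. \<bar>t - s\<bar> powr p)"
  unfolding abs_continuous_on_interval_def
proof (intro allI impI)
  fix e :: real assume "e > 0"
  \<comment> \<open>Chosen with eta^p = e/8, so that \<open>Q\<close> below ranges over an interval
    of length e/4.\<close>
  define \<eta> where "\<eta> = (e / 8) powr (1 / p)"
  have "\<eta> > 0" and \<eta>: "\<eta> powr p = e / 8"
    using \<open>e > 0\<close> \<open>p > 0\<close> by (auto simp: \<eta>_def powr_powr)
  define B where "B = max \<bar>a - s\<bar> \<bar>b - s\<bar> + \<eta>"
  \<comment> \<open>On [eta, B] the derivative p z^(p-1) is largest at the right end if p >= 1 and
    at the left end otherwise; the sum covers both cases, and the 1 makes \<open>L\<close>
    positive.\<close>
  define L where "L = p * (B powr (p - 1) + \<eta> powr (p - 1)) + 1"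
  have "L > 0" using \<open>p > 0\<close> by (simp add: L_def add_nonneg_pos)
  have lip: "y powr p - x powr p \<le> L * (y - x)" if "\<eta> \<le> x" "x \<le> y" "y \<le> B" for x y
  proof (cases "x = y")
    case False
    have "\<exists>z>x. z < y \<and> y powr p - x powr p = (y - x) * (p * z powr (p - 1))"
      using that False \<open>\<eta> > 0\<close> by (intro MVT2) (auto intro!: derivative_eq_intros)
    then obtain z where z: "x < z" "z < y" and eq: "y powr p - x powr p = (y - x) * (p * z powr (p - 1))"
      by blast
    have "z powr (p - 1) \<le> B powr (p - 1) + \<eta> powr (p - 1)"
    proof (cases "p \<ge> 1")
      case True
      then have "z powr (p - 1) \<le> B powr (p - 1)"
        using z that \<open>\<eta> > 0\<close> by (intro powr_mono2) auto
      then show ?thesis by (simp add: add_increasing2)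
    next
      case False
      then have "z powr (p - 1) \<le> \<eta> powr (p - 1)"
        using z that \<open>\<eta> > 0\<close> by (intro powr_mono2') auto
      then show ?thesis by (simp add: add_increasing)
    qed
    then have "p * z powr (p - 1) \<le> L"
      using \<open>p > 0\<close> unfolding L_def by (smt (verit) mult_left_mono)
    then show ?thesis
      unfolding eq using z by (simp add: mult.commute mult_left_mono)
  qed simp
  define m where "m = (\<lambda>x. min \<bar>x\<bar> \<eta> powr p)"
  \<comment> \<open>The even function \<open>m\<close> falls and then rises; changing its sign to
    the left of s makes it monotone, with increments that dominate those of
    \<open>m\<close>.\<close>
  define Q where "Q = (\<lambda>x. sgn (x - s) * m (x - s))"
  have m_mono: "m x \<le> m y" if "\<bar>x\<bar> \<le> \<bar>y\<bar>" for x y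
    unfolding m_def using that \<open>p > 0\<close> \<open>\<eta> > 0\<close> by (intro powr_mono2) auto
  have m0: "m 0 = 0" "m x \<ge> 0" for x
    using \<open>\<eta> > 0\<close> by (simp_all add: m_def)
  have m_le: "m x \<le> e / 8" for x
    unfolding m_def \<eta>[symmetric] using \<open>\<eta> > 0\<close> \<open>p > 0\<close> by (intro powr_mono2) auto
  have m_split: "\<bar>m (v - s) - m (u - s)\<bar> \<le> Q v - Q u" if "u \<le> v" for u v
    using that m_mono[of "v - s" "u - s"] m_mono[of "u - s" "v - s"] m0(2)[of "v - s"] m0(2)[of "u - s"] m0(1)
    by (auto simp: Q_def sgn_if)
  then have "mono Q"
    by (intro monoI) (smt (verit))
  have Q_range: "- e / 8 \<le> Q x" "Q x \<le> e / 8" for x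
    using m_le[of "x - s"] m0(2)[of "x - s"] \<open>e > 0\<close> by (auto simp: Q_def sgn_if)
  have key: "\<bar>\<bar>v - s\<bar> powr p - \<bar>u - s\<bar> powr p\<bar> \<le> (Q v - Q u) + L * (v - u)"
    if "a \<le> u" "u < v" "v \<le> b" for u v
  proof -
    define M where "M = (\<lambda>x. max \<bar>x\<bar> \<eta> powr p)"
    have sp: "\<bar>x\<bar> powr p = m x + M x - e / 8" for x
      by (auto simp: m_def M_def \<eta>[symmetric] min_def max_def)
    have bd: "max \<bar>x - s\<bar> \<eta> \<le> B" if "a \<le> x" "x \<le> b" for x
      using that \<open>\<eta> > 0\<close> unfolding B_def by linarith
    have half: "M (y - s) - M (x - s) \<le> L * \<bar>y - x\<bar>" if "a \<le> x" "x \<le> b" "a \<le> y" "y \<le> b" for x y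
    proof (cases "max \<bar>x - s\<bar> \<eta> \<le> max \<bar>y - s\<bar> \<eta>")
      case True
      have "M (y - s) - M (x - s) \<le> L * (max \<bar>y - s\<bar> \<eta> - max \<bar>x - s\<bar> \<eta>)"
        unfolding M_def using True bd that by (intro lip) auto
      also have "\<dots> \<le> L * \<bar>y - x\<bar>"
        using \<open>L > 0\<close> by (intro mult_left_mono) auto
      finally show ?thesis .
    next
      case False
      then have "M (y - s) \<le> M (x - s)"
        unfolding M_def using \<open>p > 0\<close> \<open>\<eta> > 0\<close> by (intro powr_mono2) auto
      moreover have "0 \<le> L * \<bar>y - x\<bar>" using \<open>L > 0\<close> by simp
      ultimately show ?thesis by linarith
    qed
    have "\<bar>M (v - s) - M (u - s)\<bar> \<le> L * (v - u)"
      using half[of u v] half[of v u] that by (auto simp: abs_if)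
    then show ?thesis
      using m_split[of u v] that unfolding sp by linarith
  qed
  show "\<exists>d>0. \<forall>I :: (real \<times> real) set. finite I \<longrightarrow>
        (\<forall>(u, v)\<in>I. a \<le> u \<and> u < v \<and> v \<le> b) \<longrightarrow>
        pairwise (\<lambda>p q. {fst p<..<snd p} \<inter> {fst q<..<snd q} = {}) I \<longrightarrow>
        (\<Sum>(u, v)\<in>I. v - u) < d \<longrightarrow>
        (\<Sum>(u, v)\<in>I. \<bar>\<bar>v - s\<bar> powr p - \<bar>u - s\<bar> powr p\<bar>) < e"
  \<comment> \<open>The Lipschitz part then contributes less than e/2, on top of at most e/4 from
    \<open>Q\<close>.\<close>
  proof (intro exI[of _ "e / (2 * L)"] conjI allI impI)
    fix I :: "(real \<times> real) set"
    assume I: "finite I" "\<forall>(u, v)\<in>I. a \<le> u \<and> u < v \<and> v \<le> b"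
      "pairwise (\<lambda>p q. {fst p<..<snd p} \<inter> {fst q<..<snd q} = {}) I"
      "(\<Sum>(u, v)\<in>I. v - u) < e / (2 * L)"
    have "ennreal (\<Sum>(u, v)\<in>I. Q v - Q u) \<le> emeasure lborel {- e / 8..e / 8}"
    proof (rule sum_mono_increments_le_emeasure)
      show "{Q u<..<Q v} \<subseteq> {- e / 8..e / 8}" for u v
        using Q_range[of u] Q_range[of v] by auto
    qed (use I \<open>mono Q\<close> in auto)
    also have "\<dots> = ennreal (e / 4)"
      using \<open>e > 0\<close> by (simp add: field_simps)
    finally have Qs: "(\<Sum>(u, v)\<in>I. Q v - Q u) \<le> e / 4"
      using \<open>e > 0\<close> by (subst (asm) ennreal_le_iff) auto
    have "(\<Sum>(u, v)\<in>I. \<bar>\<bar>v - s\<bar> powr p - \<bar>u - s\<bar> powr p\<bar>) \<le> (\<Sum>(u, v)\<in>I. (Q v - Q u) + L * (v - u))"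
      using I(2) key by (intro sum_mono) fastforce
    also have "\<dots> = (\<Sum>(u, v)\<in>I. Q v - Q u) + L * (\<Sum>(u, v)\<in>I. v - u)"
      by (simp add: sum.distrib split_def sum_distrib_left)
    also have "L * (\<Sum>(u, v)\<in>I. v - u) < e / 2"
      using I(4) \<open>L > 0\<close> by (simp add: field_simps)
    finally show "(\<Sum>(u, v)\<in>I. \<bar>\<bar>v - s\<bar> powr p - \<bar>u - s\<bar> powr p\<bar>) < e"
      using Qs \<open>e > 0\<close> by linarith
  qed (use \<open>e > 0\<close> \<open>L > 0\<close> in simp)
qed

lemma abs_continuous_on_interval_fbm_cov:
  assumes "H > 0"
  shows "abs_continuous_on_interval 0 T (fbm_cov H s)"
proof (rule abs_continuous_on_interval_bound)
  show "abs_continuous_on_interval 0 T (\<lambda>t. \<bar>t - 0\<bar> powr (2 * H))"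
    "abs_continuous_on_interval 0 T (\<lambda>t. \<bar>t - s\<bar> powr (2 * H))"
    using assms by (intro abs_continuous_on_interval_abs_powr; simp)+
  show "\<bar>fbm_cov H s v - fbm_cov H s u\<bar> \<le> \<bar>\<bar>v - 0\<bar> powr (2 * H) - \<bar>u - 0\<bar> powr (2 * H)\<bar> +
      \<bar>\<bar>v - s\<bar> powr (2 * H) - \<bar>u - s\<bar> powr (2 * H)\<bar>" if "0 \<le> u" "u < v" for u v
  proof -
    have "\<bar>(c + x - y) / 2 - (c + x' - y') / 2\<bar> \<le> \<bar>x - x'\<bar> + \<bar>y - y'\<bar>" for c x x' y y' :: real
    proof -
      have "(c + x - y) / 2 - (c + x' - y') / 2 = ((x - x') - (y - y')) / 2"
        by (simp add: field_simps)
      then show ?thesis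
        by (simp only: abs_if) (auto simp: field_simps)
    qed
    then show ?thesis
      using that by (simp only: fbm_cov_def abs_of_nonneg diff_zero)
  qed
qed

text \<open>A gauge argument: near a point of differentiability the increments of \<open>f\<close> are dominated
  by those of \<open>g\<close>, while the intervals tagged by exceptional points have small total length, so
  absolute continuity makes their contribution negligible.\<close>

lemma abs_continuous_on_interval_increment_le:
  fixes a b :: real
  assumes "a \<le> b" and f: "abs_continuous_on_interval a b f"
    and g: "\<And>x y. a \<le> x \<Longrightarrow> x \<le> y \<Longrightarrow> y \<le> b \<Longrightarrow> g x \<le> g y"
    and ae: "AE x in lborel. x \<in> {a..b} \<longrightarrow>
      (\<exists>d d'. (f has_real_derivative d) (at x within {a..b}) \<and>
              (g has_real_derivative d') (at x within {a..b}) \<and> \<bar>d\<bar> \<le> d')"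
  shows "\<bar>f b - f a\<bar> \<le> g b - g a"
proof (rule field_le_epsilon)
  fix e0 :: real assume "e0 > 0"
  \<comment> \<open>The final error is e from the exceptional intervals plus 2 e (b - a) from the
    others, which is e0 for this choice.\<close>
  define e where "e = e0 / (2 * (b - a) + 1)"
  have "e > 0" using \<open>e0 > 0\<close> \<open>a \<le> b\<close> by (simp add: e_def)
  obtain \<delta> where "\<delta> > 0" and \<delta>: "\<And>I :: (real \<times> real) set. finite I \<Longrightarrow>
        \<forall>(u, v)\<in>I. a \<le> u \<and> u < v \<and> v \<le> b \<Longrightarrow>
        pairwise (\<lambda>p q. {fst p<..<snd p} \<inter> {fst q<..<snd q} = {}) I \<Longrightarrow>
        (\<Sum>(u, v)\<in>I. v - u) < \<delta> \<Longrightarrow> (\<Sum>(u, v)\<in>I. \<bar>f v - f u\<bar>) < e"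
    using f \<open>e > 0\<close> unfolding abs_continuous_on_interval_def by blast
  obtain N where "N \<in> null_sets lborel"
    and good: "\<And>x. x \<notin> N \<Longrightarrow> x \<in> {a..b} \<Longrightarrow>
      \<exists>d d'. (f has_real_derivative d) (at x within {a..b}) \<and>
              (g has_real_derivative d') (at x within {a..b}) \<and> \<bar>d\<bar> \<le> d'"
    using ae by (rule AE_E3) auto
  then have N: "N \<in> sets borel" "emeasure lborel N = 0" by auto
  \<comment> \<open>Cells tagged in \<open>N\<close> will be confined to \<open>U\<close>, so their
    total length stays below the threshold of absolute continuity.\<close>
  obtain U where U: "open U" "N \<subseteq> U" "emeasure lborel (U - N) < ennreal \<delta>"
    using outer_regular_lborel[of N \<delta>] N(1) \<open>\<delta> > 0\<close> by auto
  have "emeasure lborel U \<le> emeasure lborel (U - N) + emeasure lborel N"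
    using U(1) N(1) by (subst emeasure_Un_null_set[symmetric] plus_emeasure) (auto intro!: emeasure_mono)
  then have Um: "emeasure lborel U < ennreal \<delta>"
    using U(3) N(2) by (simp add: order.strict_trans1)
  \<comment> \<open>Straddle estimate: as x lies between y and z, the errors e |y - x| and e |z - x|
    add up to exactly e (z - y), once for \<open>f\<close> and once for \<open>g\<close>.\<close>
  have "\<exists>r>0. \<forall>y z. y \<in> {a..b} \<longrightarrow> z \<in> {a..b} \<longrightarrow> y \<in> ball x r \<longrightarrow> z \<in> ball x r \<longrightarrow> y \<le> x \<longrightarrow> x \<le> z \<longrightarrow>
      \<bar>f z - f y\<bar> \<le> g z - g y + 2 * e * (z - y)" if x: "x \<notin> N" "x \<in> {a..b}" for x
  proof -
    obtain d d' where d: "(f has_real_derivative d) (at x within {a..b})"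
      "(g has_real_derivative d') (at x within {a..b})" "\<bar>d\<bar> \<le> d'"
      using good[OF x] by blast
    obtain r1 where r1: "r1 > 0" "\<And>y. y \<in> {a..b} \<Longrightarrow> \<bar>y - x\<bar> < r1 \<Longrightarrow> \<bar>f y - f x - (y - x) * d\<bar> \<le> e * \<bar>y - x\<bar>"
      using d(1) \<open>e > 0\<close> unfolding has_field_derivative_def has_derivative_within_alt
      by (auto simp: mult.commute dest!: spec[of _ e])
    obtain r2 where r2: "r2 > 0" "\<And>y. y \<in> {a..b} \<Longrightarrow> \<bar>y - x\<bar> < r2 \<Longrightarrow> \<bar>g y - g x - (y - x) * d'\<bar> \<le> e * \<bar>y - x\<bar>"
      using d(2) \<open>e > 0\<close> unfolding has_field_derivative_def has_derivative_within_alt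
      by (auto simp: mult.commute dest!: spec[of _ e])
    show ?thesis
    proof (intro exI[of _ "min r1 r2"] conjI allI impI)
      fix y z assume yz: "y \<in> {a..b}" "z \<in> {a..b}" "y \<in> ball x (min r1 r2)" "z \<in> ball x (min r1 r2)" "y \<le> x" "x \<le> z"
      have near: "\<bar>y - x\<bar> < r1" "\<bar>z - x\<bar> < r1" "\<bar>y - x\<bar> < r2" "\<bar>z - x\<bar> < r2"
        using yz(3,4) by (simp_all add: dist_real_def abs_minus_commute)
      have abs: "\<bar>y - x\<bar> = x - y" "\<bar>z - x\<bar> = z - x" using yz(5,6) by simp_all
      note b = r1(2)[OF yz(1) near(1)] r1(2)[OF yz(2) near(2)]
        r2(2)[OF yz(1) near(3)] r2(2)[OF yz(2) near(4)]
      have "e * (z - y) = e * (z - x) + e * (x - y)" "(z - y) * d = (z - x) * d - (y - x) * d"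
        "(z - y) * d' = (z - x) * d' - (y - x) * d'"
        by (simp_all add: algebra_simps)
      then have "\<bar>f z - f y\<bar> \<le> \<bar>(z - y) * d\<bar> + e * (z - y)" "(z - y) * d' - e * (z - y) \<le> g z - g y"
        using b unfolding abs abs_le_iff by linarith+
      moreover have "\<bar>(z - y) * d\<bar> \<le> (z - y) * d'"
        using d(3) yz(5,6) by (auto simp: abs_mult intro: mult_left_mono)
      ultimately show "\<bar>f z - f y\<bar> \<le> g z - g y + 2 * e * (z - y)" by simp
    qed (use r1 r2 in simp)
  qed
  then obtain r where r: "\<And>x. x \<notin> N \<Longrightarrow> x \<in> {a..b} \<Longrightarrow> r x > 0"
    "\<And>x y z. x \<notin> N \<Longrightarrow> x \<in> {a..b} \<Longrightarrow> y \<in> {a..b} \<Longrightarrow> z \<in> {a..b} \<Longrightarrow> y \<in> ball x (r x) \<Longrightarrow>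
      z \<in> ball x (r x) \<Longrightarrow> y \<le> x \<Longrightarrow> x \<le> z \<Longrightarrow> \<bar>f z - f y\<bar> \<le> g z - g y + 2 * e * (z - y)"
    by metis
  \<comment> \<open>The last branch is arbitrary: tags of a division of [a, b] lie in
    [a, b].\<close>
  define \<gamma> where "\<gamma> x = (if x \<in> N then U else if x \<in> {a..b} then ball x (r x) else UNIV)" for x
  have "gauge \<gamma>"
    unfolding gauge_def \<gamma>_def using U r(1) by auto
  then obtain p where p: "p tagged_division_of {a..b}" "\<gamma> fine p"
    by (rule fine_division_exists_real)
  note pD = tagged_division_ofD[OF p(1)]
  have K: "a \<le> Inf K \<and> Inf K \<le> x \<and> x \<le> Sup K \<and> Sup K \<le> b \<and> K = {Inf K..Sup K}" if xK: "(x, K) \<in> p" for x K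
  proof -
    obtain c d where cd: "K = {c..d}" using pD(4)[OF xK] by auto
    moreover have "x \<in> K" "K \<subseteq> {a..b}" using pD(2,3)[OF xK] by auto
    ultimately show ?thesis by auto
  qed
  \<comment> \<open>Absolute continuity speaks of intervals with u < v only; degenerate cells are
    left out, and their increments vanish.\<close>
  define p1 where "p1 = {(x, K) \<in> p. x \<in> N \<and> Inf K < Sup K}"
  define I where "I = (\<lambda>(x, K). (Inf K, Sup K)) ` p1"
  have sub: "p1 \<subseteq> p" and fin: "finite p" "finite p1"
    using pD(1) by (auto simp: p1_def intro: finite_subset[of _ p])
  have disj: "{Inf K<..<Sup K} \<inter> {Inf K'<..<Sup K'} = {}"
    if "(x, K) \<in> p" "(x', K') \<in> p" "(x, K) \<noteq> (x', K')" for x K x' K'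
  proof -
    have "interior K \<inter> interior K' = {}" using pD(5)[OF that] .
    moreover have "{Inf K<..<Sup K} = interior K" "{Inf K'<..<Sup K'} = interior K'"
      using K that(1,2) interior_atLeastAtMost_real by metis+
    ultimately show ?thesis by simp
  qed
  \<comment> \<open>Two distinct cells with the same endpoints would have disjoint interiors,
    impossible for nondegenerate cells. This lets the sum over endpoint pairs be read as a sum over
    cells.\<close>
  have inj: "inj_on (\<lambda>(x, K). (Inf K, Sup K)) p1"
  proof (rule inj_onI, clarify)
    fix x K x' K' assume *: "(x, K) \<in> p1" "(x', K') \<in> p1" "Inf K = Inf K'" "Sup K = Sup K'"
    have "{Inf K<..<Sup K} \<noteq> {}" using *(1) by (auto simp: p1_def)
    then show "x = x' \<and> K = K'"
      using disj[of x K x' K'] * sub by auto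
  qed
  have "finite I" using fin by (simp add: I_def)
  have I1: "\<forall>(u, v)\<in>I. a \<le> u \<and> u < v \<and> v \<le> b"
    using K by (auto simp: I_def p1_def)
  have I2: "pairwise (\<lambda>p q. {fst p<..<snd p} \<inter> {fst q<..<snd q} = {}) I"
  proof (rule pairwiseI)
    fix q q' assume "q \<in> I" "q' \<in> I" "q \<noteq> q'"
    then obtain x K x' K' where "(x, K) \<in> p" "(x', K') \<in> p" "q = (Inf K, Sup K)" "q' = (Inf K', Sup K')"
      using sub unfolding I_def by fastforce
    then show "{fst q<..<snd q} \<inter> {fst q'<..<snd q'} = {}"
      using disj[of x K x' K'] \<open>q \<noteq> q'\<close> by auto
  qed
  have "ennreal (\<Sum>(u, v)\<in>I. v - u) \<le> emeasure lborel U"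
  proof (rule sum_mono_increments_le_emeasure[where q = "\<lambda>x. x"])
    fix u v assume "(u, v) \<in> I"
    then obtain x K where xK: "(x, K) \<in> p" "x \<in> N" "u = Inf K" "v = Sup K"
      by (auto simp: I_def p1_def)
    then have "K \<subseteq> U" using fineD[OF p(2) xK(1)] by (simp add: \<gamma>_def)
    then show "{u<..<v} \<subseteq> U" using K[OF xK(1)] xK(3,4) by auto
  qed (use \<open>finite I\<close> I1 I2 U(1) in \<open>auto simp: mono_def\<close>)
  then have "ennreal (\<Sum>(u, v)\<in>I. v - u) < ennreal \<delta>"
    using Um by (rule order.strict_trans1)
  then have "(\<Sum>(u, v)\<in>I. v - u) < \<delta>"
    by (meson ennreal_leI not_le)
  then have "(\<Sum>(u, v)\<in>I. \<bar>f v - f u\<bar>) < e"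
    using \<open>finite I\<close> I1 I2 by (intro \<delta>)
  then have small: "(\<Sum>(x, K)\<in>p1. \<bar>f (Sup K) - f (Inf K)\<bar>) < e"
    unfolding I_def by (subst (asm) sum.reindex[OF inj]) (simp add: split_def o_def)
  have "\<bar>f b - f a\<bar> = \<bar>\<Sum>(x, K)\<in>p. f (Sup K) - f (Inf K)\<bar>"
    using additive_tagged_division_1[OF \<open>a \<le> b\<close> p(1), of f] by simp
  also have "\<dots> \<le> (\<Sum>(x, K)\<in>p. \<bar>f (Sup K) - f (Inf K)\<bar>)"
    unfolding split_def by (rule sum_abs)
  also have "\<dots> = (\<Sum>(x, K)\<in>p1. \<bar>f (Sup K) - f (Inf K)\<bar>) + (\<Sum>(x, K)\<in>p - p1. \<bar>f (Sup K) - f (Inf K)\<bar>)"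
    using sub fin by (subst sum.subset_diff[of p1 p]) auto
  also have "\<dots> \<le> e + (\<Sum>(x, K)\<in>p - p1. \<bar>f (Sup K) - f (Inf K)\<bar>)"
    using small by simp
  also have "(\<Sum>(x, K)\<in>p - p1. \<bar>f (Sup K) - f (Inf K)\<bar>) \<le>
      (\<Sum>(x, K)\<in>p - p1. (g (Sup K) - g (Inf K)) + 2 * e * (Sup K - Inf K))"
  proof (rule sum_mono, clarify)
    fix x K assume xK: "(x, K) \<in> p" "(x, K) \<notin> p1"
    note k = K[OF xK(1)]
    show "\<bar>f (Sup K) - f (Inf K)\<bar> \<le> (g (Sup K) - g (Inf K)) + 2 * e * (Sup K - Inf K)"
    proof (cases "x \<in> N")
      case True
      then have "Inf K = Sup K" using xK k by (auto simp: p1_def)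
      then show ?thesis by simp
    next
      case False
      then have "K \<subseteq> ball x (r x)"
        using fineD[OF p(2) xK(1)] k by (simp add: \<gamma>_def)
      moreover have "Inf K \<in> K" "Sup K \<in> K" using k by (metis atLeastAtMost_iff order_refl order_trans)+
      ultimately show ?thesis
        using k False by (intro r(2)[of x]) auto
    qed
  qed
  \<comment> \<open>As \<open>g\<close> is monotone the omitted terms are nonnegative; over the
    whole division the sum telescopes.\<close>
  also have "\<dots> \<le> (\<Sum>(x, K)\<in>p. (g (Sup K) - g (Inf K)) + 2 * e * (Sup K - Inf K))"
  proof (rule sum_mono2)
    fix q assume "q \<in> p - (p - p1)"
    then obtain x K where q: "q = (x, K)" "(x, K) \<in> p" by (metis DiffD1 surj_pair)
    note k = K[OF q(2)]
    show "0 \<le> (case q of (x, K) \<Rightarrow> (g (Sup K) - g (Inf K)) + 2 * e * (Sup K - Inf K))"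
      using g[of "Inf K" "Sup K"] k \<open>e > 0\<close> by (simp add: q)
  qed (use fin in auto)
  also have "\<dots> = (\<Sum>(x, K)\<in>p. g (Sup K) - g (Inf K)) + 2 * e * (\<Sum>(x, K)\<in>p. Sup K - Inf K)"
    by (simp add: sum.distrib split_def sum_distrib_left)
  also have "\<dots> = (g b - g a) + 2 * e * (b - a)"
    using additive_tagged_division_1[OF \<open>a \<le> b\<close> p(1), of g] additive_tagged_division_1[OF \<open>a \<le> b\<close> p(1), of "\<lambda>x. x"]
    by simp
  finally have "\<bar>f b - f a\<bar> \<le> g b - g a + e * (2 * (b - a) + 1)"
    by (simp add: algebra_simps)
  also have "e * (2 * (b - a) + 1) = e0"
    using \<open>a \<le> b\<close> by (simp add: e_def)
  finally show "\<bar>f b - f a\<bar> \<le> g b - g a + e0" by simp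
qed

section \<open>Covariances of type (A)\<close>

text \<open>For a covariance function this is the covariance of the increments over [s, s'] and
  [t, t']; for a smooth \<open>R\<close> it is the integral of the mixed derivative over the
  rectangle.\<close>

definition rect_incr :: "(real \<Rightarrow> real \<Rightarrow> real) \<Rightarrow> real \<Rightarrow> real \<Rightarrow> real \<Rightarrow> real \<Rightarrow> real" where
  "rect_incr R s s' t t' = R s' t' - R s' t - R s t' + R s t"

text \<open>The right-hand side is the integral of C (t s)^(H-1) over the rectangle, with K = C /
  H^2. The comparison theorem is used first in s, on \<open>D\<close>, and then in t, on the
  difference of the two covariances, whose derivative in t is an increment of \<open>D\<close> in
  s.\<close>

lemma type_A_rect_incr_bound:
  assumes "type_A T H R"
  obtains K where "K \<ge> 0" and "\<And>s s' t t'. 0 \<le> s \<Longrightarrow> s \<le> s' \<Longrightarrow> s' \<le> T \<Longrightarrow> 0 \<le> t \<Longrightarrow> t \<le> t' \<Longrightarrow> t' \<le> T \<Longrightarrow>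
    \<bar>rect_incr R s s' t t' - rect_incr (fbm_cov H) s s' t t'\<bar> \<le>
      K * (s' powr H - s powr H) * (t' powr H - t powr H)"
proof -
  from assms obtain D C where "0 < H" and R: "\<And>s. s \<in> {0..T} \<Longrightarrow> abs_continuous_on_interval 0 T (R s)"
    and Dt: "\<And>s. s \<in> {0..T} \<Longrightarrow> AE t in lborel. t \<in> {0..T} \<longrightarrow>
           (\<exists>r b. (R s has_real_derivative r) (at t within {0..T}) \<and>
                  (fbm_cov H s has_real_derivative b) (at t within {0..T}) \<and> D s t = r - b)"
    and D: "\<And>t. t \<in> {0..T} \<Longrightarrow> abs_continuous_on_interval 0 T (\<lambda>s. D s t)"
    and "C > 0" and Ds: "AE (s, t) in lborel \<Otimes>\<^sub>M lborel. s \<in> {0..T} \<longrightarrow> t \<in> {0..T} \<longrightarrow>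
           (\<exists>d. ((\<lambda>s. D s t) has_real_derivative d) (at s within {0..T}) \<and> \<bar>d\<bar> \<le> C * (t * s) powr (H - 1))"
    unfolding type_A_def by blast
  \<comment> \<open>The order of the variables is swapped so that t is fixed first: \<open>D\<close>
    is absolutely continuous in s for each t.\<close>
  have Ds': "AE t in lborel. AE s in lborel. s \<in> {0..T} \<longrightarrow> t \<in> {0..T} \<longrightarrow>
           (\<exists>d. ((\<lambda>s. D s t) has_real_derivative d) (at s within {0..T}) \<and> \<bar>d\<bar> \<le> C * (t * s) powr (H - 1))"
  proof -
    have "AE p in lborel \<Otimes>\<^sub>M lborel. case (case p of (t, s) \<Rightarrow> (s, t)) of (s, t) \<Rightarrow> s \<in> {0..T} \<longrightarrow> t \<in> {0..T} \<longrightarrow>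
           (\<exists>d. ((\<lambda>s. D s t) has_real_derivative d) (at s within {0..T}) \<and> \<bar>d\<bar> \<le> C * (t * s) powr (H - 1))"
      using Ds by (subst (asm) lborel_pair.distr_pair_swap) (rule AE_distrD[OF measurable_pair_swap'])
    from lborel_pair.AE_pair[OF this] show ?thesis by simp
  qed
  have powr_mono_H: "x powr H \<le> y powr H" if "0 \<le> x" "x \<le> y" for x y :: real
    using that \<open>0 < H\<close> by (intro powr_mono2) auto
  have powr_deriv: "((\<lambda>x. c * (x powr H / H)) has_real_derivative c * x powr (H - 1)) (at x within S)"
    if "0 < x" for c x S
    using that \<open>0 < H\<close> by (auto intro!: derivative_eq_intros)
  have inner: "AE t in lborel. t \<in> {0..T} \<longrightarrow>
      \<bar>D s' t - D s t\<bar> \<le> C * t powr (H - 1) * ((s' powr H - s powr H) / H)"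
    if s: "0 \<le> s" "s \<le> s'" "s' \<le> T" for s s'
    using Ds'
  proof eventually_elim
    fix t assume ae: "AE x in lborel. x \<in> {0..T} \<longrightarrow> t \<in> {0..T} \<longrightarrow>
           (\<exists>d. ((\<lambda>s. D s t) has_real_derivative d) (at x within {0..T}) \<and> \<bar>d\<bar> \<le> C * (t * x) powr (H - 1))"
    show "t \<in> {0..T} \<longrightarrow> \<bar>D s' t - D s t\<bar> \<le> C * t powr (H - 1) * ((s' powr H - s powr H) / H)"
    proof
      assume t: "t \<in> {0..T}"
      define g where "g = (\<lambda>x. C * t powr (H - 1) * (x powr H / H))"
      have "\<bar>D s' t - D s t\<bar> \<le> g s' - g s"
      proof (rule abs_continuous_on_interval_increment_le)
        show "abs_continuous_on_interval s s' (\<lambda>s. D s t)"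
          using D[OF t] s by (rule_tac abs_continuous_on_interval_subset) auto
        show "g x \<le> g y" if "s \<le> x" "x \<le> y" "y \<le> s'" for x y
          unfolding g_def using that s \<open>0 < H\<close> \<open>0 < C\<close>
          by (intro mult_left_mono divide_right_mono powr_mono_H) auto
        show "AE x in lborel. x \<in> {s..s'} \<longrightarrow>
          (\<exists>d d'. ((\<lambda>s. D s t) has_real_derivative d) (at x within {s..s'}) \<and>
              (g has_real_derivative d') (at x within {s..s'}) \<and> \<bar>d\<bar> \<le> d')"
          \<comment> \<open>The point 0 is discarded as a null set, since x^H has no finite
            derivative there.\<close>
          using ae AE_lborel_singleton[of 0]
        proof eventually_elim
          case (elim x)
          show ?case
          proof
            assume x: "x \<in> {s..s'}"
            then have "x \<in> {0..T}" "0 < x" using s elim(2) by auto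
            then obtain d where d: "((\<lambda>s. D s t) has_real_derivative d) (at x within {0..T})"
              "\<bar>d\<bar> \<le> C * (t * x) powr (H - 1)"
              using elim(1) t by blast
            have "((\<lambda>s. D s t) has_real_derivative d) (at x within {s..s'})"
              using d(1) by (rule DERIV_subset) (use s in auto)
            moreover have "(g has_real_derivative C * t powr (H - 1) * x powr (H - 1)) (at x within {s..s'})"
              unfolding g_def using \<open>0 < x\<close> by (rule powr_deriv)
            moreover have "\<bar>d\<bar> \<le> C * t powr (H - 1) * x powr (H - 1)"
              using d(2) t \<open>0 < x\<close> by (simp add: powr_mult)
            ultimately show "\<exists>d d'. ((\<lambda>s. D s t) has_real_derivative d) (at x within {s..s'}) \<and>
              (g has_real_derivative d') (at x within {s..s'}) \<and> \<bar>d\<bar> \<le> d'" by blast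
          qed
        qed
      qed (fact s)
      then show "\<bar>D s' t - D s t\<bar> \<le> C * t powr (H - 1) * ((s' powr H - s powr H) / H)"
        by (simp add: g_def diff_divide_distrib right_diff_distrib)
    qed
  qed
  show thesis
  proof (rule that[of "C / H\<^sup>2"])
    show "0 \<le> C / H\<^sup>2" using \<open>C > 0\<close> by simp
    fix s s' t t' assume s: "0 \<le> s" "s \<le> s'" "s' \<le> T" and t: "0 \<le> t" "t \<le> t'" "t' \<le> T"
    define A where "A = C * ((s' powr H - s powr H) / H)"
    have "A \<ge> 0" unfolding A_def using \<open>C > 0\<close> \<open>0 < H\<close> powr_mono_H[of s s'] s by simp
    define g where "g = (\<lambda>x. A * (x powr H / H))"
    \<comment> \<open>Its derivative is (r' - r) - (b' - b) = D s' x - D s x at almost every x,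
      which the first application bounds by A x^(H-1).\<close>
    define F where "F = (\<lambda>x. (R s' x - R s x) - (fbm_cov H s' x - fbm_cov H s x))"
    have "s \<in> {0..T}" "s' \<in> {0..T}" using s by auto
    have "\<bar>F t' - F t\<bar> \<le> g t' - g t"
    proof (rule abs_continuous_on_interval_increment_le)
      have 1: "abs_continuous_on_interval 0 T (\<lambda>x. R s' x - R s x)"
        using R[OF \<open>s' \<in> {0..T}\<close>] R[OF \<open>s \<in> {0..T}\<close>]
        by (rule abs_continuous_on_interval_bound) linarith
      have 2: "abs_continuous_on_interval 0 T (\<lambda>x. fbm_cov H s' x - fbm_cov H s x)"
        using abs_continuous_on_interval_fbm_cov[OF \<open>0 < H\<close>, of T s'] abs_continuous_on_interval_fbm_cov[OF \<open>0 < H\<close>, of T s]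
        by (rule abs_continuous_on_interval_bound) linarith
      have "abs_continuous_on_interval 0 T F"
        using 1 2 unfolding F_def by (rule abs_continuous_on_interval_bound) linarith
      then show "abs_continuous_on_interval t t' F"
        using t by (rule_tac abs_continuous_on_interval_subset) auto
      show "g x \<le> g y" if "t \<le> x" "x \<le> y" "y \<le> t'" for x y
        unfolding g_def using that t \<open>0 < H\<close> \<open>0 \<le> A\<close>
        by (intro mult_left_mono divide_right_mono powr_mono_H) auto
      show "AE x in lborel. x \<in> {t..t'} \<longrightarrow>
          (\<exists>d d'. (F has_real_derivative d) (at x within {t..t'}) \<and>
              (g has_real_derivative d') (at x within {t..t'}) \<and> \<bar>d\<bar> \<le> d')"
        using Dt[OF \<open>s \<in> {0..T}\<close>] Dt[OF \<open>s' \<in> {0..T}\<close>] inner[OF s] AE_lborel_singleton[of 0]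
      proof eventually_elim
        case (elim x)
        show ?case
        proof
          assume x: "x \<in> {t..t'}"
          then have x0: "x \<in> {0..T}" "0 < x" using t elim(4) by auto
          obtain r b where rb: "(R s has_real_derivative r) (at x within {0..T})"
                  "(fbm_cov H s has_real_derivative b) (at x within {0..T})" "D s x = r - b"
            using elim(1) x0 by blast
          obtain r' b' where rb': "(R s' has_real_derivative r') (at x within {0..T})"
                  "(fbm_cov H s' has_real_derivative b') (at x within {0..T})" "D s' x = r' - b'"
            using elim(2) x0 by blast
          have "(F has_real_derivative (r' - r) - (b' - b)) (at x within {0..T})"
            unfolding F_def by (intro DERIV_diff rb rb')
          then have "(F has_real_derivative (r' - r) - (b' - b)) (at x within {t..t'})"
            by (rule DERIV_subset) (use t in auto)
          moreover have "(g has_real_derivative A * x powr (H - 1)) (at x within {t..t'})"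
            unfolding g_def using \<open>0 < x\<close> by (rule powr_deriv)
          moreover have "\<bar>(r' - r) - (b' - b)\<bar> \<le> A * x powr (H - 1)"
            using elim(3) x0(1) rb(3) rb'(3) by (simp add: A_def algebra_simps)
          ultimately show "\<exists>d d'. (F has_real_derivative d) (at x within {t..t'}) \<and>
              (g has_real_derivative d') (at x within {t..t'}) \<and> \<bar>d\<bar> \<le> d'" by blast
        qed
      qed
    qed (fact t)
    moreover have "F t' - F t = rect_incr R s s' t t' - rect_incr (fbm_cov H) s s' t t'"
      by (simp add: F_def rect_incr_def)
    moreover have "g t' - g t = C / H\<^sup>2 * (s' powr H - s powr H) * (t' powr H - t powr H)"
      using \<open>0 < H\<close> by (simp add: g_def A_def power2_eq_square field_simps)
    ultimately show "\<bar>rect_incr R s s' t t' - rect_incr (fbm_cov H) s s' t t'\<bar> \<le>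
      C / H\<^sup>2 * (s' powr H - s powr H) * (t' powr H - t powr H)" by simp
  qed
qed

section \<open>Fractional Gaussian noise\<close>

text \<open>Convexity of x^p: the derivative p x^(p-1) is nondecreasing.\<close>

lemma mono_diff_powr:
  fixes p x y :: real
  assumes "1 \<le> p" "0 \<le> x" "x \<le> y"
  shows "(x + 1) powr p - x powr p \<le> (y + 1) powr p - y powr p"
proof (rule DERIV_nonneg_imp_increasing_open[OF assms(3)])
  show "continuous_on {x..y} (\<lambda>x. (x + 1) powr p - x powr p)"
    using assms by (intro continuous_on_diff continuous_on_powr' continuous_on_add continuous_on_id continuous_on_const) auto
  fix z assume z: "x < z" "z < y"
  have "((\<lambda>x. (x + 1) powr p - x powr p) has_real_derivative p * ((z + 1) powr (p - 1) - z powr (p - 1))) (at z)"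
    using z assms by (auto intro!: derivative_eq_intros simp: right_diff_distrib)
  moreover have "0 \<le> p * ((z + 1) powr (p - 1) - z powr (p - 1))"
    using z assms by (intro mult_nonneg_nonneg) (auto intro!: powr_mono2)
  ultimately show "\<exists>d. ((\<lambda>x. (x + 1) powr p - x powr p) has_real_derivative d) (at z) \<and> 0 \<le> d"
    by blast
qed

text \<open>Concavity of x^p. The slope at 0 is infinite for p < 1, so the derivative test looks at
  interior points only.\<close>

lemma antimono_diff_powr:
  fixes p x y :: real
  assumes "0 < p" "p \<le> 1" "0 \<le> x" "x \<le> y"
  shows "(y + 1) powr p - y powr p \<le> (x + 1) powr p - x powr p"
proof (rule DERIV_nonpos_imp_decreasing_open[OF assms(4)])
  show "continuous_on {x..y} (\<lambda>x. (x + 1) powr p - x powr p)"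
    using assms by (intro continuous_on_diff continuous_on_powr' continuous_on_add continuous_on_id continuous_on_const) auto
  fix z assume z: "x < z" "z < y"
  have "((\<lambda>x. (x + 1) powr p - x powr p) has_real_derivative p * ((z + 1) powr (p - 1) - z powr (p - 1))) (at z)"
    using z assms by (auto intro!: derivative_eq_intros simp: right_diff_distrib)
  moreover have "p * ((z + 1) powr (p - 1) - z powr (p - 1)) \<le> 0"
    using z assms by (intro mult_nonneg_nonpos) (auto intro!: powr_mono2')
  ultimately show "\<exists>d. ((\<lambda>x. (x + 1) powr p - x powr p) has_real_derivative d) (at z) \<and> d \<le> 0"
    by blast
qed

lemma diff_powr_bounds:
  fixes p x :: real
  assumes "0 < p" "p \<le> 1" "0 \<le> x"
  shows "0 \<le> (x + 1) powr p - x powr p" and "(x + 1) powr p - x powr p \<le> 1"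
  using antimono_diff_powr[of p 0 x] powr_mono2[of p x "x + 1"] assms by simp_all

text \<open>The function \<open>\<rho>\<close> of the overview: half the symmetric second difference
  of |x|^(2H). At lag 0 it equals 1, as \<open>0 powr (2 * H)\<close> is 0.\<close>

definition fgn_cov :: "real \<Rightarrow> real \<Rightarrow> real" where
  "fgn_cov H x = (\<bar>x + 1\<bar> powr (2 * H) + \<bar>x - 1\<bar> powr (2 * H) - 2 * \<bar>x\<bar> powr (2 * H)) / 2"

lemma fgn_cov_abs: "fgn_cov H \<bar>x\<bar> = fgn_cov H x"
proof (cases "x \<ge> 0")
  case False
  then have "\<bar>- x + 1\<bar> = \<bar>x - 1\<bar>" "\<bar>- x - 1\<bar> = \<bar>x + 1\<bar>" by linarith+
  then show ?thesis using False by (simp add: fgn_cov_def)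
qed simp

text \<open>Presents the second difference as an increment of first differences, ready for
  telescoping.\<close>

lemma fgn_cov_Suc:
  "fgn_cov H (real (Suc m)) =
    (((real m + 1 + 1) powr (2 * H) - (real m + 1) powr (2 * H)) - ((real m + 1) powr (2 * H) - real m powr (2 * H))) / 2"
  by (simp add: fgn_cov_def algebra_simps)

text \<open>For 2H <= 1 both first differences lie in [0, 1]. For 2H > 1 the mean value theorem
  gives 2H times a first difference of x^(2H-1), whose exponent is now below 1, so the value lies in
  [0, 2].\<close>

lemma abs_fgn_cov_le_1:
  assumes "0 < H" "H < 1"
  shows "\<bar>fgn_cov H (real m)\<bar> \<le> 1"
proof (cases m)
  case 0
  then show ?thesis by (simp add: fgn_cov_def)
next
  case (Suc k)
  let ?g = "\<lambda>x. (x + 1) powr (2 * H) - x powr (2 * H)"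
  have "\<bar>?g (real k + 1) - ?g (real k)\<bar> \<le> 2"
  proof (cases "2 * H \<le> 1")
    case True
    then show ?thesis
      using diff_powr_bounds[of "2 * H" "real k + 1"] diff_powr_bounds[of "2 * H" "real k"] assms by simp
  next
    case False
    have "\<exists>l z. real k < z \<and> z < real k + 1 \<and> (?g has_real_derivative l) (at z) \<and>
        ?g (real k + 1) - ?g (real k) = (real k + 1 - real k) * l"
    proof (rule MVT)
      show "continuous_on {real k..real k + 1} ?g"
        using assms by (intro continuous_on_diff continuous_on_powr' continuous_on_add continuous_on_id continuous_on_const) auto
      show "?g differentiable (at z)" if "real k < z" for z
        using that unfolding real_differentiable_def
        by (intro exI[of _ "2 * H * ((z + 1) powr (2 * H - 1) - z powr (2 * H - 1))"])
           (auto intro!: derivative_eq_intros simp: right_diff_distrib)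
    qed simp
    then obtain l z where z: "real k < z" "(?g has_real_derivative l) (at z)" "?g (real k + 1) - ?g (real k) = l"
      by auto
    have "(?g has_real_derivative 2 * H * ((z + 1) powr (2 * H - 1) - z powr (2 * H - 1))) (at z)"
      using z(1) by (auto intro!: derivative_eq_intros simp: right_diff_distrib)
    then have l: "l = 2 * H * ((z + 1) powr (2 * H - 1) - z powr (2 * H - 1))"
      using z(2) DERIV_unique by blast
    have b: "0 \<le> (z + 1) powr (2 * H - 1) - z powr (2 * H - 1)" "(z + 1) powr (2 * H - 1) - z powr (2 * H - 1) \<le> 1"
      using diff_powr_bounds[of "2 * H - 1" z] z(1) False assms by auto
    have "0 \<le> l" "l \<le> 2 * 1"
      unfolding l using assms b by (intro mult_nonneg_nonneg mult_mono; simp)+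
    then show ?thesis using z(3) by linarith
  qed
  then show ?thesis unfolding Suc fgn_cov_Suc by simp
qed

lemma sum_abs_fgn_cov:
  assumes "0 < H"
  shows "(\<Sum>m<n. \<bar>fgn_cov H (real (Suc m))\<bar>) = \<bar>((real n + 1) powr (2 * H) - real n powr (2 * H)) - 1\<bar> / 2"
proof -
  define g where "g = (\<lambda>x. (x + 1) powr (2 * H) - x powr (2 * H))"
  \<comment> \<open>The sign of the second difference: +1 when x^(2H) is convex, -1 when it is
    concave. Then s * g is nondecreasing, and g 0 = 1 is the constant subtracted in the
    result.\<close>
  define s :: real where "s = (if 1 \<le> 2 * H then 1 else -1)"
  have le: "s * g x \<le> s * g y" if "0 \<le> x" "x \<le> y" for x y
    using mono_diff_powr[of "2 * H" x y] antimono_diff_powr[of "2 * H" x y] that assms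
    by (auto simp: s_def g_def)
  have abs: "\<bar>g y - g x\<bar> = s * g y - s * g x" if "0 \<le> x" "x \<le> y" for x y
    using le[OF that] by (auto simp: s_def split: if_splits)
  have eq: "fgn_cov H (real (Suc m)) = (g (real (Suc m)) - g (real m)) / 2" for m
    unfolding fgn_cov_Suc by (simp add: g_def add_ac)
  have "\<bar>fgn_cov H (real (Suc m))\<bar> = (s * g (real (Suc m)) - s * g (real m)) / 2" for m
    unfolding eq abs_divide by (subst abs) simp_all
  then have "(\<Sum>m<n. \<bar>fgn_cov H (real (Suc m))\<bar>) = (\<Sum>m<n. (s * g (real (Suc m)) - s * g (real m)) / 2)"
    by (simp only:)
  also have "\<dots> = (s * g (real n) - s * g 0) / 2"
    using sum_lessThan_telescope[of "\<lambda>m. s * g (real m)" n] by (simp flip: sum_divide_distrib)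
  also have "s * g (real n) - s * g 0 = \<bar>g (real n) - 1\<bar>"
    by (subst abs[symmetric]) (simp_all add: g_def)
  finally show ?thesis by (simp add: g_def)
qed

text \<open>Since the summands are at most 1, squares may be replaced by absolute values, and those
  telescope because \<open>fgn_cov\<close> has a constant sign on the positive integers.\<close>

lemma sum_fgn_cov_squared_le:
  assumes "0 < H" "H < 1" "0 < n"
  shows "(\<Sum>m<n. (fgn_cov H (real m))\<^sup>2) \<le> 3 * real n powr max 0 (2 * H - 1)"
proof -
  obtain k where n: "n = Suc k" using \<open>0 < n\<close> by (cases n) auto
  \<comment> \<open>Growth of the last first difference: bounded if 2H <= 1, of order n^(2H-1)
    otherwise.\<close>
  let ?A = "real n powr max 0 (2 * H - 1)"
  have "1 \<le> ?A" using \<open>0 < n\<close> by (intro ge_one_powr_ge_zero) auto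
  have g: "0 \<le> (real k + 1) powr (2 * H) - real k powr (2 * H)"
    using assms by (simp add: powr_mono2)
  have g': "(real k + 1) powr (2 * H) - real k powr (2 * H) \<le> 2 * ?A"
  proof (cases "2 * H \<le> 1")
    case True
    then show ?thesis
      using diff_powr_bounds(2)[of "2 * H" "real k"] assms \<open>1 \<le> ?A\<close> by simp
  next
    case False
    have "\<exists>l z. real k < z \<and> z < real k + 1 \<and> ((\<lambda>x. x powr (2 * H)) has_real_derivative l) (at z) \<and>
        (real k + 1) powr (2 * H) - real k powr (2 * H) = (real k + 1 - real k) * l"
    proof (rule MVT)
      show "continuous_on {real k..real k + 1} (\<lambda>x. x powr (2 * H))"
        using assms by (intro continuous_on_diff continuous_on_powr' continuous_on_add continuous_on_id continuous_on_const) auto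
      show "(\<lambda>x. x powr (2 * H)) differentiable (at z)" if "real k < z" for z
        using that unfolding real_differentiable_def
        by (intro exI[of _ "2 * H * z powr (2 * H - 1)"]) (auto intro!: derivative_eq_intros)
    qed simp
    then obtain l z where z: "real k < z" "z < real k + 1" "((\<lambda>x. x powr (2 * H)) has_real_derivative l) (at z)"
      "(real k + 1) powr (2 * H) - real k powr (2 * H) = l"
      by auto
    have "((\<lambda>x. x powr (2 * H)) has_real_derivative 2 * H * z powr (2 * H - 1)) (at z)"
      using z(1) by (auto intro!: derivative_eq_intros)
    then have "l = 2 * H * z powr (2 * H - 1)"
      using z(3) DERIV_unique by blast
    also have "\<dots> \<le> 2 * (real k + 1) powr (2 * H - 1)"
      using assms False z by (intro mult_mono powr_mono2) auto
    finally show ?thesis using z(4) False by (simp add: n add_ac)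
  qed
  \<comment> \<open>Lag 0 is split off because it need not share the sign of the other lags.\<close>
  have "(\<Sum>m<n. (fgn_cov H (real m))\<^sup>2) = 1 + (\<Sum>m<k. (fgn_cov H (real (Suc m)))\<^sup>2)"
    unfolding n by (subst sum.lessThan_Suc_shift) (simp add: fgn_cov_def)
  also have "(\<Sum>m<k. (fgn_cov H (real (Suc m)))\<^sup>2) \<le> (\<Sum>m<k. \<bar>fgn_cov H (real (Suc m))\<bar>)"
  proof (rule sum_mono)
    fix m
    have "\<bar>fgn_cov H (real (Suc m))\<bar> * \<bar>fgn_cov H (real (Suc m))\<bar> \<le> \<bar>fgn_cov H (real (Suc m))\<bar> * 1"
      by (intro mult_left_mono abs_fgn_cov_le_1 assms) simp
    then show "(fgn_cov H (real (Suc m)))\<^sup>2 \<le> \<bar>fgn_cov H (real (Suc m))\<bar>"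
      by (simp add: power2_eq_square)
  qed
  also have "\<dots> \<le> (2 * ?A + 1) / 2"
    unfolding sum_abs_fgn_cov[OF assms(1)] using g g' \<open>1 \<le> ?A\<close> by (intro divide_right_mono) auto
  finally have "(\<Sum>m<n. (fgn_cov H (real m))\<^sup>2) \<le> 1 + (2 * ?A + 1) / 2" by simp
  then show ?thesis using \<open>1 \<le> ?A\<close> by (simp add: field_simps)
qed

text \<open>In a fixed row, each lag occurs at most once on either side of the diagonal, so a row
  costs at most twice the one-sided sum.\<close>

lemma sum_sum_fgn_cov_squared_le:
  assumes "0 < H" "H < 1" "0 < n"
  shows "(\<Sum>j = 1..n. \<Sum>k = 1..n. (fgn_cov H (real j - real k))\<^sup>2) \<le> 6 * real n * real n powr max 0 (2 * H - 1)"
proof -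
  let ?B = "\<Sum>m<n. (fgn_cov H (real m))\<^sup>2"
  have row: "(\<Sum>k = 1..n. (fgn_cov H (real j - real k))\<^sup>2) \<le> 2 * ?B" if "j \<in> {1..n}" for j
  proof -
    have part: "(\<Sum>k\<in>S. (fgn_cov H (real j - real k))\<^sup>2) \<le> ?B"
      if "inj_on f S" "f ` S \<subseteq> {..<n}" "\<And>k. k \<in> S \<Longrightarrow> \<bar>real j - real k\<bar> = real (f k)" for S and f :: "nat \<Rightarrow> nat"
    proof -
      have "(\<Sum>k\<in>S. (fgn_cov H (real j - real k))\<^sup>2) = (\<Sum>k\<in>S. (fgn_cov H (real (f k)))\<^sup>2)"
        by (intro sum.cong refl) (metis fgn_cov_abs that(3))
      also have "\<dots> = (\<Sum>m\<in>f ` S. (fgn_cov H (real m))\<^sup>2)"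
        using that(1) by (simp add: sum.reindex)
      also have "\<dots> \<le> ?B"
        using that(2) by (intro sum_mono2) auto
      finally show ?thesis .
    qed
    have "{1..n} = {1..j} \<union> {j<..n}" using that by auto
    then have "(\<Sum>k = 1..n. (fgn_cov H (real j - real k))\<^sup>2) =
        (\<Sum>k = 1..j. (fgn_cov H (real j - real k))\<^sup>2) + (\<Sum>k\<in>{j<..n}. (fgn_cov H (real j - real k))\<^sup>2)"
      by (simp only:) (rule sum.union_disjoint, auto)
    also have "\<dots> \<le> ?B + ?B"
    proof (rule add_mono)
      show "(\<Sum>k = 1..j. (fgn_cov H (real j - real k))\<^sup>2) \<le> ?B"
        using that by (intro part[of "\<lambda>k. j - k"]) (auto simp: inj_on_def)
      show "(\<Sum>k\<in>{j<..n}. (fgn_cov H (real j - real k))\<^sup>2) \<le> ?B"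
        using that by (intro part[of "\<lambda>k. k - j"]) (auto simp: inj_on_def)
    qed
    finally show ?thesis by simp
  qed
  have "(\<Sum>j = 1..n. \<Sum>k = 1..n. (fgn_cov H (real j - real k))\<^sup>2) \<le> (\<Sum>j = 1..n. 2 * ?B)"
    by (intro sum_mono row)
  also have "\<dots> = real n * (2 * ?B)" by simp
  also have "\<dots> \<le> real n * (2 * (3 * real n powr max 0 (2 * H - 1)))"
    by (intro mult_left_mono sum_fgn_cov_squared_le assms) auto
  finally show ?thesis by simp
qed

section \<open>Almost sure convergence\<close>

text \<open>By monotone convergence the series of squares has finite integral, so it converges
  almost everywhere and its terms tend to 0.\<close>

lemma AE_tendsto_0_if_summable_second_moments:
  fixes Z :: "nat \<Rightarrow> 'a \<Rightarrow> real"
  assumes Z: "\<And>n. Z n \<in> borel_measurable M" and int: "\<And>n. integrable M (\<lambda>\<omega>. (Z n \<omega>)\<^sup>2)"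
    and sum: "summable (\<lambda>n. \<integral>\<omega>. (Z n \<omega>)\<^sup>2 \<partial>M)"
  shows "AE \<omega> in M. (\<lambda>n. Z n \<omega>) \<longlonglongrightarrow> 0"
proof -
  note Z[measurable]
  have "(\<integral>\<^sup>+\<omega>. (\<Sum>n. ennreal ((Z n \<omega>)\<^sup>2)) \<partial>M) = (\<Sum>n. \<integral>\<^sup>+\<omega>. ennreal ((Z n \<omega>)\<^sup>2) \<partial>M)"
    by (rule nn_integral_suminf) simp
  also have "\<dots> = (\<Sum>n. ennreal (\<integral>\<omega>. (Z n \<omega>)\<^sup>2 \<partial>M))"
    by (intro suminf_cong nn_integral_eq_integral int) simp
  also have "\<dots> = ennreal (\<Sum>n. \<integral>\<omega>. (Z n \<omega>)\<^sup>2 \<partial>M)"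
    by (intro suminf_ennreal2 sum) simp
  finally have "(\<integral>\<^sup>+\<omega>. (\<Sum>n. ennreal ((Z n \<omega>)\<^sup>2)) \<partial>M) \<noteq> \<infinity>" by simp
  then have "AE \<omega> in M. (\<Sum>n. ennreal ((Z n \<omega>)\<^sup>2)) \<noteq> \<infinity>"
    by (intro nn_integral_noteq_infinite) simp_all
  then show ?thesis
  proof eventually_elim
    case (elim \<omega>)
    then have "summable (\<lambda>n. (Z n \<omega>)\<^sup>2)"
      by (intro summable_suminf_not_top) simp_all
    then have "(\<lambda>n. (Z n \<omega>)\<^sup>2) \<longlonglongrightarrow> 0" by (rule summable_LIMSEQ_zero)
    then have "(\<lambda>n. sqrt ((Z n \<omega>)\<^sup>2)) \<longlonglongrightarrow> sqrt 0" by (rule tendsto_real_sqrt)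
    then show ?case by (simp add: tendsto_rabs_zero_iff)
  qed
qed

lemma (in prob_space) variance_sum:
  fixes Y :: "'i \<Rightarrow> 'a \<Rightarrow> real"
  assumes "\<And>i. i \<in> I \<Longrightarrow> integrable M (Y i)"
    and "\<And>i j. i \<in> I \<Longrightarrow> j \<in> I \<Longrightarrow> integrable M (\<lambda>\<omega>. Y i \<omega> * Y j \<omega>)"
  shows "integrable M (\<lambda>\<omega>. ((\<Sum>i\<in>I. Y i \<omega>) - (\<Sum>i\<in>I. expectation (Y i)))\<^sup>2)"
    and "expectation (\<lambda>\<omega>. ((\<Sum>i\<in>I. Y i \<omega>) - (\<Sum>i\<in>I. expectation (Y i)))\<^sup>2) =
      (\<Sum>i\<in>I. \<Sum>j\<in>I. expectation (\<lambda>\<omega>. Y i \<omega> * Y j \<omega>) - expectation (Y i) * expectation (Y j))"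
proof -
  have eq: "((\<Sum>i\<in>I. Y i \<omega>) - (\<Sum>i\<in>I. expectation (Y i)))\<^sup>2 =
    (\<Sum>i\<in>I. \<Sum>j\<in>I. Y i \<omega> * Y j \<omega> - expectation (Y j) * Y i \<omega> - expectation (Y i) * Y j \<omega>
      + expectation (Y i) * expectation (Y j))" for \<omega>
    by (simp add: sum_subtractf[symmetric] power2_eq_square sum_product algebra_simps)
  have i: "integrable M (\<lambda>\<omega>. Y i \<omega> * Y j \<omega> - expectation (Y j) * Y i \<omega> - expectation (Y i) * Y j \<omega>
      + expectation (Y i) * expectation (Y j))" if "i \<in> I" "j \<in> I" for i j
    using assms that by simp
  show "integrable M (\<lambda>\<omega>. ((\<Sum>i\<in>I. Y i \<omega>) - (\<Sum>i\<in>I. expectation (Y i)))\<^sup>2)"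
    unfolding eq by (intro Bochner_Integration.integrable_sum i)
  have "expectation (\<lambda>\<omega>. ((\<Sum>i\<in>I. Y i \<omega>) - (\<Sum>i\<in>I. expectation (Y i)))\<^sup>2) =
    (\<Sum>i\<in>I. \<Sum>j\<in>I. expectation (\<lambda>\<omega>. Y i \<omega> * Y j \<omega> - expectation (Y j) * Y i \<omega> - expectation (Y i) * Y j \<omega>
      + expectation (Y i) * expectation (Y j)))"
    unfolding eq by (simp add: Bochner_Integration.integral_sum Bochner_Integration.integrable_sum i)
  also have "\<dots> = (\<Sum>i\<in>I. \<Sum>j\<in>I. expectation (\<lambda>\<omega>. Y i \<omega> * Y j \<omega>) - expectation (Y i) * expectation (Y j))"
    using assms by (intro sum.cong refl) (simp add: prob_space)
  finally show "expectation (\<lambda>\<omega>. ((\<Sum>i\<in>I. Y i \<omega>) - (\<Sum>i\<in>I. expectation (Y i)))\<^sup>2) =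
      (\<Sum>i\<in>I. \<Sum>j\<in>I. expectation (\<lambda>\<omega>. Y i \<omega> * Y j \<omega>) - expectation (Y i) * expectation (Y j))" .
qed

section \<open>Quadratic variation along the dyadic grid\<close>

text \<open>Stationary increments and self-similarity: the terms in one variable cancel, the others
  depend on differences only, and the mesh comes out as h^(2H).\<close>

lemma rect_incr_fbm_cov_grid:
  assumes "h > 0"
  shows "rect_incr (fbm_cov H) ((j - 1) * h) (j * h) ((k - 1) * h) (k * h) = h powr (2 * H) * fgn_cov H (j - k)"
proof -
  have p: "\<bar>x * h - y * h\<bar> powr (2 * H) = h powr (2 * H) * \<bar>x - y\<bar> powr (2 * H)" for x y
    using assms by (simp add: left_diff_distrib[symmetric] abs_mult powr_mult)
  have a: "\<bar>k - j\<bar> = \<bar>j - k\<bar>" "\<bar>k - 1 - (j - 1)\<bar> = \<bar>j - k\<bar>" "\<bar>k - 1 - j\<bar> = \<bar>j - k + 1\<bar>" "\<bar>k - (j - 1)\<bar> = \<bar>j - k - 1\<bar>"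
    by linarith+
  show ?thesis
    unfolding rect_incr_def fbm_cov_def p a fgn_cov_def by (simp add: field_simps)
qed

lemma grid_point_in_interval:
  assumes "i \<in> {1..2 ^ n}" and "0 \<le> T"
  shows "(real i - 1) * (T / 2 ^ n) \<in> {0..T}" and "real i * (T / 2 ^ n) \<in> {0..T}"
proof -
  let ?h = "T / 2 ^ n"
  have i: "1 \<le> real i" "real i \<le> 2 ^ n"
    using assms(1) of_nat_le_iff[of i "2 ^ n", where ?'a = real] by simp_all
  have "0 \<le> ?h" using assms(2) by simp
  have "0 \<le> (real i - 1) * ?h" "(real i - 1) * ?h \<le> 2 ^ n * ?h" "0 \<le> real i * ?h" "real i * ?h \<le> 2 ^ n * ?h"
    using i \<open>0 \<le> ?h\<close> by (intro mult_right_mono mult_nonneg_nonneg; linarith)+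
  then show "(real i - 1) * (T / 2 ^ n) \<in> {0..T}" "real i * (T / 2 ^ n) \<in> {0..T}" by simp_all
qed

text \<open>Isolates what both types share. The diagonal sum of \<open>\<theta>\<close> shifts the
  mean, the sum of its squares enlarges the variance, and one exponent governs both.\<close>

lemma quadratic_variation_AE:
  fixes T H K \<beta> :: real
  assumes T: "T > 0" and H: "0 < H" "H < 1" and G: "centred_gaussian_process M {0..T} G"
    and K: "K \<ge> 0" and \<beta>: "\<beta> < 1"
    and cov: "\<And>n j k. j \<in> {1..2 ^ n} \<Longrightarrow> k \<in> {1..2 ^ n} \<Longrightarrow>
      rect_incr (cov_fun M G) ((real j - 1) * (T / 2 ^ n)) (real j * (T / 2 ^ n)) ((real k - 1) * (T / 2 ^ n)) (real k * (T / 2 ^ n)) =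
        (T / 2 ^ n) powr (2 * H) * (fgn_cov H (real j - real k) + \<theta> n j k)"
    and diag: "\<And>n. (\<Sum>k = 1..2 ^ n. \<bar>\<theta> n k k\<bar>) \<le> K * (2 ^ n) powr \<beta>"
    and offdiag: "\<And>n. (\<Sum>j = 1..2 ^ n. \<Sum>k = 1..2 ^ n. (\<theta> n j k)\<^sup>2) \<le> (K * (2 ^ n) powr \<beta>)\<^sup>2"
  shows "AE \<omega> in M.
    (\<lambda>n::nat. (2 ^ n / T) powr (2 * H - 1) *
       (\<Sum>k = 1..2 ^ n. (G (real k * (T / 2 ^ n)) \<omega> - G ((real k - 1) * (T / 2 ^ n)) \<omega>)\<^sup>2)) \<longlonglongrightarrow> T"
proof -
  interpret prob_space M
    using G by (simp add: centred_gaussian_process_def)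
  define h where "h n = T / 2 ^ n" for n :: nat
  define c where "c n = (2 ^ n / T) powr (2 * H - 1)" for n :: nat
  define X where "X n k \<omega> = G (real k * h n) \<omega> - G ((real k - 1) * h n) \<omega>" for n k \<omega>
  define S where "S n \<omega> = (\<Sum>k = 1..2 ^ n. (X n k \<omega>)\<^sup>2)" for n \<omega>
  define s where "s n = (\<Sum>k = 1..2 ^ n. expectation (\<lambda>\<omega>. (X n k \<omega>)\<^sup>2))" for n
  define r where "r n j k = fgn_cov H (real j - real k) + \<theta> n j k" for n j k
  have pow: "(2 ^ n) powr x = (2 powr x) ^ n" for n :: nat and x :: real
    by (simp add: powr_powr mult.commute flip: powr_realpow)
  have h: "h n > 0" for n using T by (simp add: h_def)
  have ch: "c n = h n powr (1 - 2 * H)" for n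
  proof -
    have "2 ^ n / T = inverse (h n)" by (simp add: h_def)
    then show ?thesis unfolding c_def by (simp add: inverse_powr powr_minus[symmetric])
  qed
  have grid: "{(real j - 1) * h n, real j * h n, (real k - 1) * h n, real k * h n} \<subseteq> {0..T}"
    if "j \<in> {1..2 ^ n}" "k \<in> {1..2 ^ n}" for n j k
    using grid_point_in_interval[of _ n T] that T unfolding h_def by auto
  have cov': "expectation (\<lambda>\<omega>. X n j \<omega> * X n k \<omega>) = h n powr (2 * H) * r n j k"
    if "j \<in> {1..2 ^ n}" "k \<in> {1..2 ^ n}" for n j k
    using centred_gaussian_process_increments(4)[OF G grid[OF that]] cov[OF that]
    unfolding X_def h_def r_def rect_incr_def by simp
  have var: "expectation (\<lambda>\<omega>. (X n k \<omega>)\<^sup>2) = h n powr (2 * H) * r n k k" if "k \<in> {1..2 ^ n}" for n k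
    using cov'[OF that that] by (simp add: power2_eq_square)
  have i2: "integrable M (\<lambda>\<omega>. (X n k \<omega>)\<^sup>2)" if "k \<in> {1..2 ^ n}" for n k
    unfolding X_def by (rule centred_gaussian_process_increments(1)[OF G grid[OF that that]])
  have i4: "integrable M (\<lambda>\<omega>. (X n j \<omega>)\<^sup>2 * (X n k \<omega>)\<^sup>2)" if "j \<in> {1..2 ^ n}" "k \<in> {1..2 ^ n}" for n j k
    unfolding X_def by (rule centred_gaussian_process_increments(2)[OF G grid[OF that]])
  have e4: "expectation (\<lambda>\<omega>. (X n j \<omega>)\<^sup>2 * (X n k \<omega>)\<^sup>2) - expectation (\<lambda>\<omega>. (X n j \<omega>)\<^sup>2) * expectation (\<lambda>\<omega>. (X n k \<omega>)\<^sup>2)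
      = 2 * (h n powr (2 * H) * r n j k)\<^sup>2" if "j \<in> {1..2 ^ n}" "k \<in> {1..2 ^ n}" for n j k
    unfolding cov'[OF that, symmetric] unfolding X_def centred_gaussian_process_increments(3)[OF G grid[OF that]] by simp
  have v: "integrable M (\<lambda>\<omega>. (S n \<omega> - s n)\<^sup>2)"
    "expectation (\<lambda>\<omega>. (S n \<omega> - s n)\<^sup>2) = (\<Sum>j = 1..2 ^ n. \<Sum>k = 1..2 ^ n. 2 * (h n powr (2 * H) * r n j k)\<^sup>2)" for n
  proof -
    show "integrable M (\<lambda>\<omega>. (S n \<omega> - s n)\<^sup>2)"
      unfolding S_def s_def by (rule variance_sum(1)[OF i2 i4])
    have "expectation (\<lambda>\<omega>. (S n \<omega> - s n)\<^sup>2) = (\<Sum>j = 1..2 ^ n. \<Sum>k = 1..2 ^ n.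
        expectation (\<lambda>\<omega>. (X n j \<omega>)\<^sup>2 * (X n k \<omega>)\<^sup>2) - expectation (\<lambda>\<omega>. (X n j \<omega>)\<^sup>2) * expectation (\<lambda>\<omega>. (X n k \<omega>)\<^sup>2))"
      unfolding S_def s_def by (rule variance_sum(2)[OF i2 i4])
    also have "\<dots> = (\<Sum>j = 1..2 ^ n. \<Sum>k = 1..2 ^ n. 2 * (h n powr (2 * H) * r n j k)\<^sup>2)"
      by (intro sum.cong refl e4)
    finally show "expectation (\<lambda>\<omega>. (S n \<omega> - s n)\<^sup>2) = \<dots>" .
  qed
  have mean: "(\<lambda>n. c n * s n) \<longlonglongrightarrow> T"
  proof -
    \<comment> \<open>The unperturbed diagonal value is 1, so its share is h n * 2 ^ n = T.\<close>
    have cs: "c n * s n = T + h n * (\<Sum>k = 1..2 ^ n. \<theta> n k k)" for n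
    proof -
      have "s n = (\<Sum>k = 1..2 ^ n. h n powr (2 * H) * (1 + \<theta> n k k))"
        unfolding s_def by (intro sum.cong refl) (simp add: var r_def fgn_cov_def)
      also have "\<dots> = h n powr (2 * H) * (2 ^ n + (\<Sum>k = 1..2 ^ n. \<theta> n k k))"
        by (simp add: sum_distrib_left[symmetric] sum.distrib)
      finally have "c n * s n = (h n powr (1 - 2 * H) * h n powr (2 * H)) * (2 ^ n + (\<Sum>k = 1..2 ^ n. \<theta> n k k))"
        by (simp add: ch)
      also have "h n powr (1 - 2 * H) * h n powr (2 * H) = h n"
        using h[of n] by (simp flip: powr_add)
      finally show ?thesis by (simp add: h_def distrib_left)
    qed
    have "(\<lambda>n. h n * (\<Sum>k = 1..2 ^ n. \<theta> n k k)) \<longlonglongrightarrow> 0"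
    proof (rule Lim_null_comparison)
      show "\<forall>\<^sub>F n in sequentially. norm (h n * (\<Sum>k = 1..2 ^ n. \<theta> n k k)) \<le> T * K * (2 powr (\<beta> - 1)) ^ n"
      proof (intro always_eventually allI)
        fix n :: nat
        have "norm (h n * (\<Sum>k = 1..2 ^ n. \<theta> n k k)) \<le> h n * (\<Sum>k = 1..2 ^ n. \<bar>\<theta> n k k\<bar>)"
          using h[of n] by (simp add: abs_mult)
        also have "\<dots> \<le> h n * (K * (2 ^ n) powr \<beta>)"
          using h[of n] by (intro mult_left_mono diag) auto
        also have "\<dots> = T * K * (2 powr (\<beta> - 1)) ^ n"
          by (simp add: h_def powr_diff power_divide pow)
        finally show "norm (h n * (\<Sum>k = 1..2 ^ n. \<theta> n k k)) \<le> T * K * (2 powr (\<beta> - 1)) ^ n" .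
      qed
      have "(2::real) powr (\<beta> - 1) < 1" using \<beta> by (intro powr_less_one) auto
      then show "(\<lambda>n. T * K * (2 powr (\<beta> - 1)) ^ n) \<longlonglongrightarrow> 0"
        by (intro tendsto_mult_right_zero LIMSEQ_power_zero) simp
    qed
    from tendsto_add[OF tendsto_const[of T] this] show ?thesis
      unfolding cs by simp
  qed
  define \<alpha> where "\<alpha> = max 0 (2 * H - 1)"
  have "\<alpha> < 1" using H by (simp add: \<alpha>_def)
  \<comment> \<open>Isserlis' theorem gives a factor 2 and (x + y)^2 <= 2 x^2 + 2 y^2 another; T^2
    comes from h^2, and 6 from the double sum of \<open>fgn_cov\<close>.\<close>
  have bound: "expectation (\<lambda>\<omega>. (c n * (S n \<omega> - s n))\<^sup>2) \<le>
      4 * T\<^sup>2 * (6 * (2 powr (\<alpha> - 1)) ^ n + K\<^sup>2 * (2 powr (2 * \<beta> - 2)) ^ n)" for n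
  proof -
    have "expectation (\<lambda>\<omega>. (c n * (S n \<omega> - s n))\<^sup>2) = (c n)\<^sup>2 * expectation (\<lambda>\<omega>. (S n \<omega> - s n)\<^sup>2)"
      by (simp add: power_mult_distrib)
    also have "expectation (\<lambda>\<omega>. (S n \<omega> - s n)\<^sup>2) = (\<Sum>j = 1..2 ^ n. \<Sum>k = 1..2 ^ n. 2 * (h n powr (2 * H) * r n j k)\<^sup>2)"
      by (rule v(2))
    also have "\<dots> = 2 * (h n powr (2 * H))\<^sup>2 * (\<Sum>j = 1..2 ^ n. \<Sum>k = 1..2 ^ n. (r n j k)\<^sup>2)"
      by (simp add: sum_distrib_left power_mult_distrib mult_ac)
    also have "(c n)\<^sup>2 * \<dots> = 2 * (h n powr (1 - 2 * H) * h n powr (2 * H))\<^sup>2 * (\<Sum>j = 1..2 ^ n. \<Sum>k = 1..2 ^ n. (r n j k)\<^sup>2)"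
      by (simp add: ch power_mult_distrib)
    also have "h n powr (1 - 2 * H) * h n powr (2 * H) = h n"
      using h[of n] by (simp flip: powr_add)
    also have "(\<Sum>j = 1..2 ^ n. \<Sum>k = 1..2 ^ n. (r n j k)\<^sup>2) \<le>
      (\<Sum>j = 1..2 ^ n. \<Sum>k = 1..2 ^ n. 2 * (fgn_cov H (real j - real k))\<^sup>2 + 2 * (\<theta> n j k)\<^sup>2)"
    proof (intro sum_mono)
      fix j k
      show "(r n j k)\<^sup>2 \<le> 2 * (fgn_cov H (real j - real k))\<^sup>2 + 2 * (\<theta> n j k)\<^sup>2"
        using zero_le_power2[of "fgn_cov H (real j - real k) - \<theta> n j k"]
        by (simp add: r_def power2_sum power2_diff)
    qed
    also have "\<dots> = 2 * (\<Sum>j = 1..2 ^ n. \<Sum>k = 1..2 ^ n. (fgn_cov H (real j - real k))\<^sup>2)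
        + 2 * (\<Sum>j = 1..2 ^ n. \<Sum>k = 1..2 ^ n. (\<theta> n j k)\<^sup>2)"
      by (simp add: sum.distrib sum_distrib_left)
    also have "\<dots> \<le> 2 * (6 * 2 ^ n * (2 ^ n) powr \<alpha>) + 2 * (K * (2 ^ n) powr \<beta>)\<^sup>2"
      using sum_sum_fgn_cov_squared_le[OF H, of "2 ^ n"] offdiag[of n] by (simp add: \<alpha>_def)
    finally have "expectation (\<lambda>\<omega>. (c n * (S n \<omega> - s n))\<^sup>2) \<le>
        2 * (h n)\<^sup>2 * (2 * (6 * 2 ^ n * (2 ^ n) powr \<alpha>) + 2 * (K * (2 ^ n) powr \<beta>)\<^sup>2)"
      by (simp add: mult_left_mono)
    also have "\<dots> = 4 * T\<^sup>2 * (6 * (2 powr (\<alpha> - 1)) ^ n + K\<^sup>2 * (2 powr (2 * \<beta> - 2)) ^ n)"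
    proof -
      have 1: "(2 powr (\<alpha> - 1)) ^ n = (2 ^ n) powr \<alpha> / (2::real) ^ n"
        by (simp add: powr_diff power_divide pow)
      have 2: "(2 powr (2 * \<beta> - 2)) ^ n = (((2 ^ n) powr \<beta>) / (2::real) ^ n)\<^sup>2"
        proof -
        have "(2::real) powr (2 * \<beta> - 2) = (2 powr \<beta> / 2)\<^sup>2"
          by (simp add: powr_diff power_divide powr_power)
        then show ?thesis
          by (simp only: pow power_divide[symmetric] power_mult[symmetric] mult.commute)
      qed
      show ?thesis
        unfolding 1 2 by (simp add: h_def field_simps power2_eq_square)
    qed
    finally show ?thesis .
  qed
  have "AE \<omega> in M. (\<lambda>n. c n * (S n \<omega> - s n)) \<longlonglongrightarrow> 0"
  proof (rule AE_tendsto_0_if_summable_second_moments)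
    have "S n \<in> borel_measurable M" for n
      unfolding S_def using i2 by (intro borel_measurable_sum) (auto dest: borel_measurable_integrable)
    then show "(\<lambda>\<omega>. c n * (S n \<omega> - s n)) \<in> borel_measurable M" for n by measurable
    show "integrable M (\<lambda>\<omega>. (c n * (S n \<omega> - s n))\<^sup>2)" for n
      using v(1)[of n] by (simp add: power_mult_distrib)
    have "(2::real) powr (\<alpha> - 1) < 1" "(2::real) powr (2 * \<beta> - 2) < 1"
      using \<beta> \<open>\<alpha> < 1\<close> by (auto intro: powr_less_one)
    then have "summable (\<lambda>n. 4 * T\<^sup>2 * (6 * (2 powr (\<alpha> - 1)) ^ n + K\<^sup>2 * (2 powr (2 * \<beta> - 2)) ^ n))"
      by (intro summable_mult summable_add summable_geometric) auto
    then show "summable (\<lambda>n. expectation (\<lambda>\<omega>. (c n * (S n \<omega> - s n))\<^sup>2))"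
      by (rule summable_comparison_test') (use bound in auto)
  qed
  then show ?thesis
  proof eventually_elim
    case (elim \<omega>)
    from tendsto_add[OF this mean] have "(\<lambda>n. c n * S n \<omega>) \<longlonglongrightarrow> T"
      by (simp add: right_diff_distrib)
    then show ?case by (simp add: c_def S_def X_def h_def)
  qed
qed


section \<open>The perturbation for types (A) and (B)\<close>

lemma sum_diff_powr_atLeast1:
  assumes "0 < p"
  shows "(\<Sum>k = 1..n. real k powr p - (real k - 1) powr p) = real n powr p"
  using assms by (induction n) simp_all

lemma diff_powr_unit_interval:
  assumes "0 < p" "p \<le> 1" "1 \<le> k"
  shows "real k powr p - (real k - 1) powr p \<in> {0..1}"
  using diff_powr_bounds[of p "real k - 1"] assms by simp

text \<open>The bound on \<open>\<theta>\<close> is a product, so double sums factor. As a k lies in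
  [0, 1], its square may be replaced by a k, and the sum of the a k telescopes to N^H.\<close>

lemma type_A_quadratic_variation_AE:
  assumes T: "T > 0" and G: "centred_gaussian_process M {0..T} G" and A: "type_A T H (cov_fun M G)"
  shows "AE \<omega> in M.
    (\<lambda>n::nat. (2 ^ n / T) powr (2 * H - 1) *
       (\<Sum>k = 1..2 ^ n. (G (real k * (T / 2 ^ n)) \<omega> - G ((real k - 1) * (T / 2 ^ n)) \<omega>)\<^sup>2)) \<longlonglongrightarrow> T"
proof -
  have H: "0 < H" "H < 1" using A by (auto simp: type_A_def)
  obtain K where "K \<ge> 0" and K: "\<And>s s' t t'. 0 \<le> s \<Longrightarrow> s \<le> s' \<Longrightarrow> s' \<le> T \<Longrightarrow> 0 \<le> t \<Longrightarrow> t \<le> t' \<Longrightarrow> t' \<le> T \<Longrightarrow>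
    \<bar>rect_incr (cov_fun M G) s s' t t' - rect_incr (fbm_cov H) s s' t t'\<bar> \<le>
      K * (s' powr H - s powr H) * (t' powr H - t powr H)"
    using type_A_rect_incr_bound[OF A] by blast
  define h where "h n = T / 2 ^ n" for n :: nat
  have h: "h n > 0" for n using T by (simp add: h_def)
  define q where "q n j k = rect_incr (cov_fun M G) ((real j - 1) * h n) (real j * h n) ((real k - 1) * h n) (real k * h n)" for n j k
  \<comment> \<open>Solved from the covariance identity that the general statement demands.\<close>
  define \<theta> where "\<theta> n j k = q n j k / h n powr (2 * H) - fgn_cov H (real j - real k)" for n j k
  define a where "a k = real k powr H - (real k - 1) powr H" for k :: nat
  have a: "0 \<le> a k" "a k \<le> 1" if "1 \<le> k" for k
    using diff_powr_unit_interval[of H k] H that by (auto simp: a_def)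
  have a_sq: "(a k)\<^sup>2 \<le> a k" if "1 \<le> k" for k
    using mult_left_mono[of "a k" 1 "a k"] a[OF that] by (simp add: power2_eq_square)
  have a_sum: "(\<Sum>k = 1..2 ^ n. a k) = (2 ^ n) powr H" for n
    unfolding a_def using sum_diff_powr_atLeast1[of H "2 ^ n"] H by simp
  have \<theta>: "\<bar>\<theta> n j k\<bar> \<le> K * (a j * a k)" if jk: "j \<in> {1..2 ^ n}" "k \<in> {1..2 ^ n}" for n j k
  proof -
    have in_T: "0 \<le> (real i - 1) * h n" "(real i - 1) * h n \<le> real i * h n" "real i * h n \<le> T" if "i \<in> {1..2 ^ n}" for i
      using grid_point_in_interval[OF that, of T] T h[of n] by (simp_all add: h_def divide_right_mono mult_right_mono)
    have powr_h: "(real i * h n) powr H - ((real i - 1) * h n) powr H = a i * h n powr H" for i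
      unfolding a_def powr_mult by (rule left_diff_distrib[symmetric])
    have "\<theta> n j k = (q n j k - h n powr (2 * H) * fgn_cov H (real j - real k)) / h n powr (2 * H)"
      using h[of n] by (simp add: \<theta>_def diff_divide_distrib)
    \<comment> \<open>Increments of x^H over a grid cell scale as h^H, so the two factors together
      cancel the division by h^(2H).\<close>
    moreover have "\<bar>q n j k - h n powr (2 * H) * fgn_cov H (real j - real k)\<bar> \<le> K * (a j * h n powr H) * (a k * h n powr H)"
      unfolding q_def rect_incr_fbm_cov_grid[OF h, symmetric] powr_h[symmetric]
      by (intro K in_T jk)
    moreover have "h n powr (2 * H) = h n powr H * h n powr H"
      by (simp flip: powr_add)
    then have "K * (a j * h n powr H) * (a k * h n powr H) = K * (a j * a k) * h n powr (2 * H)"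
      by (simp only: mult_ac)
    ultimately show ?thesis
      using h[of n] by (simp add: abs_divide pos_divide_le_eq)
  qed
  show ?thesis
  proof (rule quadratic_variation_AE[OF T H G \<open>K \<ge> 0\<close> \<open>H < 1\<close>, of \<theta>])
    show "rect_incr (cov_fun M G) ((real j - 1) * (T / 2 ^ n)) (real j * (T / 2 ^ n)) ((real k - 1) * (T / 2 ^ n)) (real k * (T / 2 ^ n)) =
        (T / 2 ^ n) powr (2 * H) * (fgn_cov H (real j - real k) + \<theta> n j k)" for n j k
      using h[of n] T unfolding \<theta>_def q_def h_def by simp
    show "(\<Sum>k = 1..2 ^ n. \<bar>\<theta> n k k\<bar>) \<le> K * (2 ^ n) powr H" for n
    proof -
      have "(\<Sum>k = 1..2 ^ n. \<bar>\<theta> n k k\<bar>) \<le> (\<Sum>k = 1..2 ^ n. K * a k)"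
      proof (rule sum_mono)
        fix k :: nat assume k: "k \<in> {1..2 ^ n}"
        have "\<bar>\<theta> n k k\<bar> \<le> K * (a k)\<^sup>2" using \<theta>[OF k k] by (simp add: power2_eq_square)
        also have "\<dots> \<le> K * a k" using a_sq k \<open>K \<ge> 0\<close> by (intro mult_left_mono) auto
        finally show "\<bar>\<theta> n k k\<bar> \<le> K * a k" .
      qed
      then show ?thesis by (simp only: a_sum sum_distrib_left[symmetric])
    qed
    show "(\<Sum>j = 1..2 ^ n. \<Sum>k = 1..2 ^ n. (\<theta> n j k)\<^sup>2) \<le> (K * (2 ^ n) powr H)\<^sup>2" for n
    proof -
      have "(\<Sum>j = 1..2 ^ n. \<Sum>k = 1..2 ^ n. (\<theta> n j k)\<^sup>2) \<le> (\<Sum>j = 1..2 ^ n. \<Sum>k = 1..2 ^ n. (K * a j) * (K * a k))"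
      proof (intro sum_mono)
        fix j k :: nat assume jk: "j \<in> {1..2 ^ n}" "k \<in> {1..2 ^ n}"
        have "(\<theta> n j k)\<^sup>2 \<le> (K * (a j * a k))\<^sup>2"
          using \<theta>[OF jk] by (simp add: abs_le_square_iff[symmetric])
        also have "\<dots> = K\<^sup>2 * ((a j)\<^sup>2 * (a k)\<^sup>2)"
          by (simp add: power_mult_distrib)
        also have "\<dots> \<le> K\<^sup>2 * (a j * a k)"
          using jk a a_sq by (intro mult_left_mono mult_mono) auto
        finally show "(\<theta> n j k)\<^sup>2 \<le> (K * a j) * (K * a k)"
          by (simp add: power2_eq_square mult_ac)
      qed
      also have "\<dots> = (\<Sum>k = 1..2 ^ n. K * a k) * (\<Sum>k = 1..2 ^ n. K * a k)"
        by (rule sum_product[symmetric])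
      finally show ?thesis by (simp only: a_sum sum_distrib_left[symmetric] power2_eq_square)
    qed
  qed
qed

text \<open>The covariance differs from that of fractional Brownian motion by (max(s,t)^(2H) -
  s^(2H) - t^(2H)) / 2. The terms in one variable have no rectangular increment. Neither has the
  maximum on cells off the diagonal, where it depends on one variable only.\<close>

lemma type_B_quadratic_variation_AE:
  assumes T: "T > 0" and G: "centred_gaussian_process M {0..T} G" and B: "type_B T H (cov_fun M G)"
  shows "AE \<omega> in M.
    (\<lambda>n::nat. (2 ^ n / T) powr (2 * H - 1) *
       (\<Sum>k = 1..2 ^ n. (G (real k * (T / 2 ^ n)) \<omega> - G ((real k - 1) * (T / 2 ^ n)) \<omega>)\<^sup>2)) \<longlonglongrightarrow> T"
proof -
  have H: "0 < H" "H < 1" "2 * H < 1" using B by (auto simp: type_B_def)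
  define a where "a k = real k powr (2 * H) - (real k - 1) powr (2 * H)" for k :: nat
  have a: "0 \<le> a k" "a k \<le> 1" if "1 \<le> k" for k
    using diff_powr_unit_interval[of "2 * H" k] H that by (auto simp: a_def)
  have a_sum: "(\<Sum>k = 1..2 ^ n. a k) = (2 ^ n) powr (2 * H)" for n
    unfolding a_def using sum_diff_powr_atLeast1[of "2 * H" "2 ^ n"] H by simp
  \<comment> \<open>On a diagonal cell the maximum contributes k^(2H) - 2 k^(2H) + (k-1)^(2H) = - a
    k, in units of h^(2H), and half of that enters the covariance.\<close>
  define \<theta> where "\<theta> j k = (if j = k then - a k / 2 else 0)" for j k
  show ?thesis
  proof (rule quadratic_variation_AE[OF T H(1,2) G zero_le_one H(3), of "\<lambda>_. \<theta>"])
    fix n j k :: nat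
    assume jk: "j \<in> {1..2 ^ n}" "k \<in> {1..2 ^ n}"
    define h where "h = T / 2 ^ n"
    have h: "h > 0" using T by (simp add: h_def)
    define m where "m x y = (max (x * h) (y * h)) powr (2 * H)" for x y :: real
    have R: "cov_fun M G s t = fbm_cov H s t + (max s t powr (2 * H) - s powr (2 * H) - t powr (2 * H)) / 2"
      if "s \<in> {0..T}" "t \<in> {0..T}" for s t
      using B that by (simp add: type_B_def fbm_cov_def field_simps)
    have in_T: "(real i - 1) * h \<in> {0..T}" "real i * h \<in> {0..T}" if "i \<in> {1..2 ^ n}" for i
      using grid_point_in_interval[OF that, of T] T by (simp_all add: h_def)
    have "rect_incr (cov_fun M G) ((real j - 1) * h) (real j * h) ((real k - 1) * h) (real k * h) =
      rect_incr (fbm_cov H) ((real j - 1) * h) (real j * h) ((real k - 1) * h) (real k * h) +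
      (m j k - m j (real k - 1) - m (real j - 1) k + m (real j - 1) (real k - 1)) / 2"
      unfolding rect_incr_def m_def using in_T[OF jk(1)] in_T[OF jk(2)] by (simp add: R field_simps)
    moreover have "m j k - m j (real k - 1) - m (real j - 1) k + m (real j - 1) (real k - 1) =
      h powr (2 * H) * (2 * \<theta> j k)"
    proof -
      have le: "x * h \<le> y * h \<longleftrightarrow> x \<le> y" for x y using h by simp
      have m: "m x y = h powr (2 * H) * max x y powr (2 * H)" if "0 \<le> x" "0 \<le> y" for x y
        unfolding m_def using that h by (simp add: max_def le powr_mult)
      have "1 \<le> real j" "1 \<le> real k" using jk by auto
      then have eq: "m j k - m j (real k - 1) - m (real j - 1) k + m (real j - 1) (real k - 1) =
        h powr (2 * H) * (max (real j) (real k) powr (2 * H) - max (real j) (real k - 1) powr (2 * H)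
          - max (real j - 1) (real k) powr (2 * H) + max (real j - 1) (real k - 1) powr (2 * H))"
        by (simp add: m algebra_simps)
      consider "j = k" | "real j + 1 \<le> real k" | "real k + 1 \<le> real j" by linarith
      then show ?thesis
        unfolding eq by cases (auto simp: \<theta>_def a_def max_absorb1 max_absorb2)
    qed
    ultimately show "rect_incr (cov_fun M G) ((real j - 1) * (T / 2 ^ n)) (real j * (T / 2 ^ n)) ((real k - 1) * (T / 2 ^ n)) (real k * (T / 2 ^ n)) =
        (T / 2 ^ n) powr (2 * H) * (fgn_cov H (real j - real k) + \<theta> j k)"
      unfolding rect_incr_fbm_cov_grid[OF h] h_def[symmetric] by (simp add: distrib_left)
  next
    fix n :: nat
    have "(\<Sum>k = 1..2 ^ n. \<bar>\<theta> k k\<bar>) \<le> (\<Sum>k = 1..2 ^ n. a k)"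
      using a by (intro sum_mono) (auto simp: \<theta>_def)
    then show "(\<Sum>k = 1..2 ^ n. \<bar>\<theta> k k\<bar>) \<le> 1 * (2 ^ n) powr (2 * H)"
      by (simp only: a_sum mult_1_left)
    have "(\<Sum>j = 1..2 ^ n. \<Sum>k = 1..2 ^ n. (\<theta> j k)\<^sup>2) = (\<Sum>j = 1..2 ^ n. \<Sum>k = 1..2 ^ n. if j = k then (a k / 2)\<^sup>2 else 0)"
      by (intro sum.cong refl) (simp add: \<theta>_def)
    also have "\<dots> = (\<Sum>k = 1..2 ^ n. (a k / 2)\<^sup>2)"
      by (simp add: sum.delta)
    also have "\<dots> \<le> (\<Sum>k = 1..2 ^ n. a k)"
    proof (rule sum_mono)
      fix k :: nat assume "k \<in> {1..2 ^ n}"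
      then have "0 \<le> a k" "a k \<le> 1" using a by simp_all
      then have "a k * a k \<le> a k * 1" by (rule mult_left_mono[rotated])
      with \<open>0 \<le> a k\<close> show "(a k / 2)\<^sup>2 \<le> a k" by (simp add: power2_eq_square)
    qed
    also have "\<dots> = (2 ^ n) powr (2 * H) * 1" by (simp only: a_sum mult_1_right)
    \<comment> \<open>A diagonal perturbation needs only the first power; the square demanded by the
      general statement is larger, as its base is at least 1.\<close>
    also have "\<dots> \<le> (2 ^ n) powr (2 * H) * (2 ^ n) powr (2 * H)"
      using H by (intro mult_left_mono ge_one_powr_ge_zero) auto
    finally show "(\<Sum>j = 1..2 ^ n. \<Sum>k = 1..2 ^ n. (\<theta> j k)\<^sup>2) \<le> (1 * (2 ^ n) powr (2 * H))\<^sup>2"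
      by (simp add: power2_eq_square)
  qed
qed

theorem theorem2p3:
  fixes M :: "'a measure" and G :: "real \<Rightarrow> 'a \<Rightarrow> real" and T H :: real
  assumes "T > 0"
    and "centred_gaussian_process M {0..T} G"
    and "AE \<omega> in M. G 0 \<omega> = 0"
    and "type_A T H (cov_fun M G) \<or> type_B T H (cov_fun M G)"
  shows "AE \<omega> in M.
    (\<lambda>n::nat. (2 ^ n / T) powr (2 * H - 1) *
       (\<Sum>k = 1..2 ^ n. (G (real k * T / 2 ^ n) \<omega> - G ((real k - 1) * T / 2 ^ n) \<omega>)\<^sup>2))
    \<longlonglongrightarrow> T"
  using type_A_quadratic_variation_AE[OF assms(1,2)] type_B_quadratic_variation_AE[OF assms(1,2)] assms(4)
  unfolding times_divide_eq_right by blast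

end
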